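(* Let $f$ be convex and $G$-Lipschitz on $\mathcal X$, i.e. $\|\nabla f(x)\|_*\le G$ for all $x\in\mathcal X$, and suppose that $x^*\in\arg\min_{x\in\mathcal X}f(x)$ exists and that the gradient oracle is unbiased with $\sigma$-sub-Gaussian noise (see context). Let $\delta\in(0,1)$ and $T\ge 1$, and let $x_1,\dots,x_{T+1}$ be the iterates of Stochastic Mirror Descent with step sizes $\{\eta_t\}$. (1) If $\eta_t=\sqrt{\dfrac{\mathbf D_\psi(x^*,x_1)}{6\left(G^2+\sigma^2(1+\log\frac1\delta)\right)T}}$ for all $1\le t\le T$, then with probability at least $1-\delta$ both $\mathbf D_\psi(x^*,x_{T+1})\le 4\,\mathbf D_\psi(x^*,x_1)$ and $$\frac1T\sum_{t=1}^T\big(f(x_t)-f(x^* )\big)\le\frac{4\sqrt6}{\sqrt T}\sqrt{\mathbf D_\psi(x^*,x_1)\Big(G^2+\sigma^2\big(1+\log\tfrac1\delta\big)\Big)}.$$ (2) If $\eta_t=\sqrt{\dfrac{\mathbf D_\psi(x^*,x_1)}{6\left(G^2+\sigma^2(1+\log\frac1\delta)\right)t}}$ for all $1\le t\le T$, then with probability at least $1-\delta$ both $\mathbf D_\psi(x^*,x_{T+1})\le 2(2+\log T)\,\mathbf D_\psi(x^*,x_1)$ and $$\frac1T\sum_{t=1}^T\big(f(x_t)-f(x^* )\big)\le\frac{2\sqrt6}{\sqrt T}(2+\log T)\sqrt{\mathbf D_\psi(x^*,x_1)\Big(G^2+\sigma^2\big(1+\log\tfrac1\delta\big)\Big)}.$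$
   Context: $\mathcal X\subseteq\mathbb R^d$ is a nonempty convex set (not necessarily bounded), $f:\mathbb R^d\to\mathbb R$ is the objective, convex, with gradient $\nabla f$. $\|\cdot\|$ is a general norm on $\mathbb R^d$ with dual norm $\|\cdot\|_*$. $\psi:\mathbb R^d\to\mathbb R$ is a differentiable mirror map that is $1$-strongly convex on $\mathcal X$ with respect to $\|\cdot\|$, and $\mathbf D_\psi(x,y)=\psi(x)-\psi(y)-\langle\nabla\psi(y),x-y\rangle$. Stochastic Mirror Descent: start from a deterministic $x_1\in\mathcal X$; for $t=1,\dots,T$, $x_{t+1}=\arg\min_{x\in\mathcal X}\{\eta_t\langle\widehat\nabla f(x_t),x\rangle+\mathbf D_\psi(x,x_t)\}$ (minimizers are assumed to exist). Noise assumptions: a random variable $Y$ is $\sigma$-sub-Gaussian ($\sigma>0$) if $\mathbb E[\exp(\lambda^2Y^2)]\le\exp(\lambda^2\sigma^2)$ for all $|\lambda|\le 1/\sigma$. $\widehat\nabla f(x)$ is a history-independent stochastic gradient oracle with $\mathbb E[\widehat\nabla f(x)\mid x]=\nabla f(x)$ and $\|\widehat\nabla f(x)-\nabla f(x)\|_*$ $\sigma$-sub-Gaussian for every $x\in\mathcal X$. Thus, with $\xi_t=\widehat\nabla f(x_t)-\nabla f(x_t)$ and $\mathcal F_t=\sigma(\xi_1,\dots,\xi_{t-1})$ (so $x_t$ is $\mathcal F_t$-measurable): $\mathbb E[\xi_t\mid\mathcal F_t]=0$ and $\mathbb E[\exp(\lambda^2\|\xi_t\|_*^2)\mid\mathcal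 F_t]\le\exp(\lambda^2\sigma^2)$ for all $|\lambda|\le1/\sigma$. *)

theory Defs
  imports "HOL-Probability.Probability"
begin

definition is_norm :: "(real ^ 'd \<Rightarrow> real) \<Rightarrow> bool" where
  "is_norm N \<longleftrightarrow>
     (\<forall>x. N x = 0 \<longleftrightarrow> x = 0) \<and>
     (\<forall>c x. N (c *\<^sub>R x) = \<bar>c\<bar> * N x) \<and>
     (\<forall>x y. N (x + y) \<le> N x + N y)"

definition dual_norm :: "(real ^ 'd \<Rightarrow> real) \<Rightarrow> real ^ 'd \<Rightarrow> real" where
  "dual_norm N y = (SUP x\<in>{x. N x \<le> 1}. y \<bullet> x)"

definition strongly_convex_on ::
  "(real ^ 'd \<Rightarrow> real) \<Rightarrow> real \<Rightarrow> (real ^ 'd) set \<Rightarrow> (real ^ 'd \<Rightarrow> real) \<Rightarrow> bool" where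
  "strongly_convex_on N \<mu> X \<psi> \<longleftrightarrow> convex X \<and>
     (\<forall>x\<in>X. \<forall>y\<in>X. \<forall>u\<in>{0..1}.
        \<psi> (u *\<^sub>R x + (1 - u) *\<^sub>R y)
          \<le> u * \<psi> x + (1 - u) * \<psi> y - \<mu> / 2 * u * (1 - u) * (N (x - y))\<^sup>2)"

definition bregman ::
  "(real ^ 'd \<Rightarrow> real) \<Rightarrow> (real ^ 'd \<Rightarrow> real ^ 'd) \<Rightarrow> real ^ 'd \<Rightarrow> real ^ 'd \<Rightarrow> real" where
  "bregman \<psi> d\<psi> x y = \<psi> x - \<psi> y - d\<psi> y \<bullet> (x - y)"

text \<open>Iterates are indexed from 1; \<open>g t \<omega>\<close> is the stochastic gradient returned by the oracle
  when it is queried at \<open>x t \<omega>\<close>.\<close>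

definition stochastic_mirror_descent ::
  "'a measure \<Rightarrow> (real ^ 'd) set \<Rightarrow> (real ^ 'd \<Rightarrow> real) \<Rightarrow> (real ^ 'd \<Rightarrow> real ^ 'd) \<Rightarrow> nat \<Rightarrow>
   (nat \<Rightarrow> real) \<Rightarrow> real ^ 'd \<Rightarrow> (nat \<Rightarrow> 'a \<Rightarrow> real ^ 'd) \<Rightarrow> (nat \<Rightarrow> 'a \<Rightarrow> real ^ 'd) \<Rightarrow> bool" where
  "stochastic_mirror_descent M X \<psi> d\<psi> T \<eta> x1 g x \<longleftrightarrow>
     (\<forall>\<omega>\<in>space M. x 1 \<omega> = x1) \<and>
     (\<forall>t\<in>{1..T}. \<forall>\<omega>\<in>space M.
        is_arg_min (\<lambda>y. \<eta> t * (g t \<omega> \<bullet> y) + bregman \<psi> d\<psi> y (x t \<omega>)) (\<lambda>y. y \<in> X)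
          (x (t + 1) \<omega>))"

definition gradient_noise ::
  "(real ^ 'd \<Rightarrow> real ^ 'd) \<Rightarrow> (nat \<Rightarrow> 'a \<Rightarrow> real ^ 'd) \<Rightarrow> (nat \<Rightarrow> 'a \<Rightarrow> real ^ 'd) \<Rightarrow>
   nat \<Rightarrow> 'a \<Rightarrow> real ^ 'd" where
  "gradient_noise df g x t \<omega> = g t \<omega> - df (x t \<omega>)"

text \<open>The sigma-algebra generated by \<open>\<xi> 1, \<dots>, \<xi> (t - 1)\<close>; for \<open>t = 1\<close> it is the trivial one.
  (A supremum of the algebras \<open>vimage_algebra\<close> would have empty space there.)\<close>

definition history :: "'a measure \<Rightarrow> (nat \<Rightarrow> 'a \<Rightarrow> real ^ 'd) \<Rightarrow> nat \<Rightarrow> 'a measure" where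
  "history M \<xi> t =
     sigma (space M) {\<xi> s -` A \<inter> space M | s A. s \<in> {1..<t} \<and> A \<in> sets borel}"

definition vec_cond_exp ::
  "'a measure \<Rightarrow> 'a measure \<Rightarrow> ('a \<Rightarrow> real ^ 'd) \<Rightarrow> 'a \<Rightarrow> real ^ 'd" where
  "vec_cond_exp M F Y \<omega> = (\<chi> i. real_cond_exp M F (\<lambda>\<omega>. Y \<omega> $ i) \<omega>)"

text \<open>The conditional expectation is the extended nonnegative one: \<open>real_cond_exp\<close> takes the
  value 0 where the conditional expectation of a nonnegative function is infinite, and so the
  bound would be void for it.\<close>

definition cond_sub_gaussian ::
  "'a measure \<Rightarrow> 'a measure \<Rightarrow> real \<Rightarrow> ('a \<Rightarrow> real) \<Rightarrow> bool" where
  "cond_sub_gaussian M F \<sigma> Y \<longleftrightarrow>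
     (\<forall>l. \<bar>l\<bar> \<le> 1 / \<sigma> \<longrightarrow>
        (AE \<omega> in M. nn_cond_exp M F (\<lambda>\<omega>. ennreal (exp (l\<^sup>2 * (Y \<omega>)\<^sup>2))) \<omega>
                      \<le> ennreal (exp (l\<^sup>2 * \<sigma>\<^sup>2))))"

text \<open>An oracle that is unbiased with \<open>\<sigma>\<close>-sub-Gaussian noise along the trajectory \<open>x\<close>,
  conditionally on the past noise.\<close>

definition unbiased_sub_gaussian_oracle ::
  "'a measure \<Rightarrow> (real ^ 'd \<Rightarrow> real) \<Rightarrow> (real ^ 'd \<Rightarrow> real ^ 'd) \<Rightarrow> real \<Rightarrow> nat \<Rightarrow>
   (nat \<Rightarrow> 'a \<Rightarrow> real ^ 'd) \<Rightarrow> (nat \<Rightarrow> 'a \<Rightarrow> real ^ 'd) \<Rightarrow> bool" where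
  "unbiased_sub_gaussian_oracle M N df \<sigma> T g x \<longleftrightarrow>
     (let \<xi> = gradient_noise df g x in
      \<forall>t\<in>{1..T}.
        g t \<in> borel_measurable M \<and>
        integrable M (\<xi> t) \<and>
        (AE \<omega> in M. vec_cond_exp M (history M \<xi> t) (\<xi> t) \<omega> = 0) \<and>
        cond_sub_gaussian M (history M \<xi> t) \<sigma> (\<lambda>\<omega>. dual_norm N (\<xi> t \<omega>)))"

end

theory Submission
  imports Defs
begin

text \<open>
  Write \<open>D t\<close> for the Bregman distance from the iterate \<open>x t\<close> to the minimizer, \<open>\<xi> t\<close> for the
  gradient noise, and \<open>w t\<close> for positive weights. The optimality condition of a mirror step and the
  convexity of \<open>f\<close> give the descent inequality (lemma \<open>stochastic_mirror_step_descent\<close>)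
  \<open>\<eta>\<^sub>t (f (x t) - f x\<^sup>*) \<le> D t - D (t + 1) + \<eta>\<^sub>t \<xi> t \<bullet> (x\<^sup>* - x t) + \<eta>\<^sub>t\<^sup>2 (G\<^sup>2 + \<parallel>\<xi> t\<parallel>\<^sub>*\<^sup>2)\<close>.
  The difficulty is the linear noise term: on an unbounded domain its size is controlled only by
  \<open>\<parallel>x\<^sup>* - x t\<parallel>\<^sup>2 \<le> 2 D t\<close>, the very quantity to be bounded.

  For sub-Gaussian noise the conditional exponential moment of \<open>\<xi> t \<bullet> a + r \<parallel>\<xi> t\<parallel>\<^sub>*\<^sup>2\<close> is at most
  \<open>exp (3 \<sigma>\<^sup>2 (\<parallel>a\<parallel>\<^sup>2 + r))\<close> whenever \<open>0 \<le> r \<le> 1 / (4 \<sigma>\<^sup>2)\<close>, for any \<open>a\<close> that depends on the past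
  only (\<open>nn_integral_exp_sub_gaussian\<close>). Multiplying such bounds along the trajectory gives a
  supermartingale, and Markov's inequality a tail bound for the weighted sum of all noise terms
  (\<open>sub_gaussian_sum_tail\<close>). Its price is \<open>6 \<sigma>\<^sup>2 (w t)\<^sup>2 \<eta>\<^sub>t\<^sup>2 D t\<close> at each step. The weights
  \<open>1 / w t = 6 \<sigma>\<^sup>2 (\<Sum>s\<le>T. \<eta>\<^sub>s\<^sup>2 + \<Sum>s\<le>t. \<eta>\<^sub>s\<^sup>2)\<close> decrease just fast enough for the weighted telescoping
  sum of the \<open>D t\<close> to pay it, yet vary only by a factor 2 (\<open>weighted_descent_bound\<close>). Hence, with
  probability at least \<open>1 - \<delta>\<close> (\<open>high_probability_bound\<close>),
  \<open>D (T + 1) + \<Sum> \<eta>\<^sub>t (f (x t) - f x\<^sup>*)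
     \<le> 2 D 1 + (2 G\<^sup>2 + 6 \<sigma>\<^sup>2 + 12 \<sigma>\<^sup>2 ln (1 / \<delta>)) \<Sum> \<eta>\<^sub>t\<^sup>2\<close>,
  and the two schedules are instances of this (\<open>schedule_bound\<close>).

  The event in question has to be measurable. Strong convexity makes a mirror step a
  Lipschitz function of its input, so the iterates are measurable with respect to the history of
  the noise (\<open>x_measurable_history\<close>).
\<close>

section \<open>Norms and dual norms\<close>

lemma is_norm_scaleR: "is_norm N \<Longrightarrow> N (c *\<^sub>R x) = \<bar>c\<bar> * N x"
  and is_norm_triangle: "is_norm N \<Longrightarrow> N (x + y) \<le> N x + N y"
  and is_norm_eq_0_iff: "is_norm N \<Longrightarrow> N x = 0 \<longleftrightarrow> x = 0"
  by (auto simp: is_norm_def)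

lemma is_norm_minus: "is_norm N \<Longrightarrow> N (- x) = N x"
  using is_norm_scaleR[of N "-1" x] by simp

lemma is_norm_minus_commute: "is_norm N \<Longrightarrow> N (x - y) = N (y - x)"
  using is_norm_minus[of N "x - y"] by simp

lemma is_norm_nonneg: "is_norm N \<Longrightarrow> 0 \<le> N x"
  using is_norm_triangle[of N x "- x"] is_norm_minus[of N x] is_norm_eq_0_iff[of N 0] by simp

lemma is_norm_convex:
  assumes "is_norm N"
  shows "convex_on UNIV N"
proof (rule convex_onI)
  fix t :: real and x y
  assume "0 < t" "t < 1"
  then show "N ((1 - t) *\<^sub>R x + t *\<^sub>R y) \<le> (1 - t) * N x + t * N y"
    using is_norm_triangle[OF assms, of "(1 - t) *\<^sub>R x" "t *\<^sub>R y"]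
    by (simp add: is_norm_scaleR[OF assms])
qed simp

lemma is_norm_continuous: "is_norm N \<Longrightarrow> continuous_on UNIV N"
  using convex_on_continuous is_norm_convex open_UNIV by blast

lemma is_norm_borel: "is_norm N \<Longrightarrow> N \<in> borel_measurable borel"
  by (intro borel_measurable_continuous_onI is_norm_continuous)

text \<open>Compactness of the Euclidean sphere; this makes the supremum in the dual norm finite.\<close>

lemma is_norm_ge_norm:
  fixes N :: "real ^ 'd \<Rightarrow> real"
  assumes N: "is_norm N"
  obtains c where "c > 0" "\<And>x. c * norm x \<le> N x"
proof -
  have "continuous_on (sphere 0 1) N"
    using is_norm_continuous[OF N] by (rule continuous_on_subset) simp
  moreover have "sphere (0 :: real ^ 'd) 1 \<noteq> {}"
    by (auto intro!: exI[of _ "axis undefined 1"] simp: norm_axis_1)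
  ultimately obtain s where s: "s \<in> sphere 0 1" and min: "\<And>y. y \<in> sphere 0 1 \<Longrightarrow> N s \<le> N y"
    using continuous_attains_inf[OF compact_sphere] by metis
  have "s \<noteq> 0" using s by auto
  then have "N s > 0"
    using is_norm_nonneg[OF N, of s] is_norm_eq_0_iff[OF N, of s] by linarith
  moreover have "N s * norm x \<le> N x" for x
  proof (cases "x = 0")
    case True
    then show ?thesis using is_norm_nonneg[OF N] by simp
  next
    case False
    then have "N s \<le> N (inverse (norm x) *\<^sub>R x)"
      by (intro min) simp
    then show ?thesis
      using False by (simp add: is_norm_scaleR[OF N] field_simps)
  qed
  ultimately show ?thesis using that by blast
qed

lemma dual_norm_bdd_above:
  assumes N: "is_norm N"
  shows "bdd_above ((\<lambda>x. y \<bullet> x) ` {x. N x \<le> 1})"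
proof -
  obtain c where c: "c > 0" "\<And>x. c * norm x \<le> N x" using is_norm_ge_norm[OF N] by blast
  have "y \<bullet> x \<le> norm y * (1 / c)" if "N x \<le> 1" for x
  proof -
    have "norm x \<le> 1 / c"
      using c(1) c(2)[of x] that by (simp add: field_simps)
    then show ?thesis
      by (meson mult_left_mono norm_cauchy_schwarz norm_ge_zero order_trans)
  qed
  then show ?thesis by (intro bdd_aboveI2) auto
qed

lemma inner_le_dual_norm:
  assumes N: "is_norm N"
  shows "y \<bullet> x \<le> dual_norm N y * N x"
proof (cases "x = 0")
  case True
  then show ?thesis using is_norm_eq_0_iff[OF N, of 0] by simp
next
  case False
  then have pos: "N x > 0"
    using is_norm_nonneg[OF N, of x] is_norm_eq_0_iff[OF N, of x] by linarith
  have "y \<bullet> (inverse (N x) *\<^sub>R x) \<le> dual_norm N y"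
    unfolding dual_norm_def
    by (intro cSUP_upper dual_norm_bdd_above N) (use pos in \<open>simp add: is_norm_scaleR[OF N]\<close>)
  then show ?thesis using pos by (simp add: field_simps)
qed

lemma dual_norm_least:
  assumes N: "is_norm N" and le: "\<And>x. N x \<le> 1 \<Longrightarrow> y \<bullet> x \<le> C"
  shows "dual_norm N y \<le> C"
  unfolding dual_norm_def
proof (rule cSUP_least)
  have "N 0 \<le> 1" using is_norm_eq_0_iff[OF N, of 0] by simp
  then show "{x. N x \<le> 1} \<noteq> {}" by blast
qed (use le in simp)

lemma dual_norm_nonneg: "is_norm N \<Longrightarrow> 0 \<le> dual_norm N y"
  unfolding dual_norm_def
  by (rule cSUP_upper2[where x = 0])
     (auto intro: dual_norm_bdd_above simp: is_norm_eq_0_iff[THEN iffD2])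

lemma abs_inner_le_dual_norm:
  assumes N: "is_norm N"
  shows "\<bar>y \<bullet> x\<bar> \<le> dual_norm N y * N x"
  using inner_le_dual_norm[OF N, of y x] inner_le_dual_norm[OF N, of y "- x"]
  by (simp add: is_norm_minus[OF N])

text \<open>The dual norm being itself a norm gives its continuity, hence its measurability, for free.\<close>

lemma is_norm_dual_norm:
  fixes N :: "real ^ 'd \<Rightarrow> real"
  assumes N: "is_norm N"
  shows "is_norm (dual_norm N)"
proof -
  have scale_le: "dual_norm N (c *\<^sub>R y) \<le> \<bar>c\<bar> * dual_norm N y" for c and y :: "real ^ 'd"
  proof (rule dual_norm_least[OF N])
    fix x :: "real ^ 'd" assume x: "N x \<le> 1"
    have "c *\<^sub>R y \<bullet> x \<le> dual_norm N y * N (c *\<^sub>R x)"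
      using inner_le_dual_norm[OF N, of y "c *\<^sub>R x"] by simp
    also have "\<dots> = \<bar>c\<bar> * dual_norm N y * N x" by (simp add: is_norm_scaleR[OF N])
    also have "\<dots> \<le> \<bar>c\<bar> * dual_norm N y"
      by (rule mult_left_le[OF x]) (simp add: dual_norm_nonneg[OF N])
    finally show "c *\<^sub>R y \<bullet> x \<le> \<bar>c\<bar> * dual_norm N y" .
  qed
  have scale: "dual_norm N (c *\<^sub>R y) = \<bar>c\<bar> * dual_norm N y" for c and y :: "real ^ 'd"
  proof (cases "c = 0")
    case True
    then show ?thesis
      using scale_le[of 0 y] dual_norm_nonneg[OF N, of 0] by simp
  next
    case False
    have "dual_norm N y \<le> \<bar>inverse c\<bar> * dual_norm N (c *\<^sub>R y)"
      using scale_le[of "inverse c" "c *\<^sub>R y"] False by simp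
    then have "\<bar>c\<bar> * dual_norm N y \<le> dual_norm N (c *\<^sub>R y)"
      using False by (simp add: field_simps)
    then show ?thesis using scale_le[of c y] by simp
  qed
  have "dual_norm N (0 :: real ^ 'd) = 0" using scale[of 0 0] by simp
  moreover have "y = 0" if "dual_norm N y = 0" for y :: "real ^ 'd"
    using inner_le_dual_norm[OF N, of y y] that inner_ge_zero[of y]
    by (metis antisym inner_eq_zero_iff mult_zero_left)
  moreover have "dual_norm N (y + z) \<le> dual_norm N y + dual_norm N z" for y z :: "real ^ 'd"
  proof (rule dual_norm_least[OF N])
    fix x :: "real ^ 'd" assume x: "N x \<le> 1"
    have "y \<bullet> x + z \<bullet> x \<le> dual_norm N y * N x + dual_norm N z * N x"
      by (intro add_mono inner_le_dual_norm N)
    also have "\<dots> \<le> dual_norm N y + dual_norm N z"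
      by (intro add_mono mult_left_le x dual_norm_nonneg N)
    finally show "(y + z) \<bullet> x \<le> dual_norm N y + dual_norm N z" by (simp add: inner_add_left)
  qed
  ultimately show ?thesis unfolding is_norm_def using scale by blast
qed

section \<open>First-order conditions\<close>

lemma GDERIV_directional_tendsto:
  fixes h :: "real ^ 'd \<Rightarrow> real"
  assumes "GDERIV h y :> d"
  shows "((\<lambda>u. (h (y + u *\<^sub>R v) - h y) / u) \<longlongrightarrow> d \<bullet> v) (at_right 0)"
proof -
  have "(h has_derivative (\<lambda>k. k \<bullet> d)) (at (y + 0 *\<^sub>R v))"
    using assms by (simp add: gderiv_def)
  moreover have "((\<lambda>u. y + u *\<^sub>R v) has_derivative (\<lambda>u. u *\<^sub>R v)) (at 0)"
    by (auto intro!: derivative_eq_intros)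
  ultimately have "((\<lambda>u. h (y + u *\<^sub>R v)) has_derivative (\<lambda>u. u *\<^sub>R v \<bullet> d)) (at 0)"
    using has_derivative_compose[of "\<lambda>u. y + u *\<^sub>R v" "\<lambda>u. u *\<^sub>R v" 0 UNIV h "\<lambda>k. k \<bullet> d"] by simp
  then have "((\<lambda>u. h (y + u *\<^sub>R v)) has_field_derivative d \<bullet> v) (at 0)"
    unfolding has_field_derivative_def
    by (rule has_derivative_eq_rhs) (simp add: fun_eq_iff inner_commute)
  then have "((\<lambda>u. (h (y + u *\<^sub>R v) - h y) / u) \<longlongrightarrow> d \<bullet> v) (at 0)"
    by (simp add: DERIV_def)
  then show ?thesis by (rule tendsto_mono[rotated]) (rule at_le, simp)
qed

text \<open>Letting \<open>u\<close> tend to 0 in the defining inequality at \<open>y + u (x - y)\<close>.\<close>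

lemma strongly_convex_on_imp_bregman_ge:
  fixes \<psi> :: "real ^ 'd \<Rightarrow> real"
  assumes sc: "strongly_convex_on N \<mu> X \<psi>" and deriv: "GDERIV \<psi> y :> d\<psi> y"
    and x: "x \<in> X" and y: "y \<in> X"
  shows "\<mu> / 2 * (N (x - y))\<^sup>2 \<le> bregman \<psi> d\<psi> x y"
proof -
  let ?c = "\<mu> / 2 * (N (x - y))\<^sup>2"
  have "d\<psi> y \<bullet> (x - y) \<le> \<psi> x - \<psi> y - (1 - 0) * ?c"
  proof (rule tendsto_le)
    show "((\<lambda>u. (\<psi> (y + u *\<^sub>R (x - y)) - \<psi> y) / u) \<longlongrightarrow> d\<psi> y \<bullet> (x - y)) (at_right 0)"
      by (rule GDERIV_directional_tendsto[OF deriv])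
    show "((\<lambda>u. \<psi> x - \<psi> y - (1 - u) * ?c) \<longlongrightarrow> \<psi> x - \<psi> y - (1 - 0) * ?c) (at_right 0)"
      by (intro tendsto_intros)
    show "\<forall>\<^sub>F u in at_right 0. (\<psi> (y + u *\<^sub>R (x - y)) - \<psi> y) / u \<le> \<psi> x - \<psi> y - (1 - u) * ?c"
    proof (rule eventually_at_rightI[of 0 1])
      fix u :: real assume u: "u \<in> {0<..<1}"
      have "y + u *\<^sub>R (x - y) = u *\<^sub>R x + (1 - u) *\<^sub>R y" by (simp add: algebra_simps)
      moreover have "\<psi> (u *\<^sub>R x + (1 - u) *\<^sub>R y)
          \<le> u * \<psi> x + (1 - u) * \<psi> y - \<mu> / 2 * u * (1 - u) * (N (x - y))\<^sup>2"
        using sc x y u unfolding strongly_convex_on_def by auto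
      ultimately have "\<psi> (y + u *\<^sub>R (x - y)) - \<psi> y \<le> (\<psi> x - \<psi> y - (1 - u) * ?c) * u"
        by (simp add: algebra_simps)
      then show "(\<psi> (y + u *\<^sub>R (x - y)) - \<psi> y) / u \<le> \<psi> x - \<psi> y - (1 - u) * ?c"
        using u by (simp add: pos_divide_le_eq)
    qed simp
  qed simp
  then show ?thesis by (simp add: bregman_def)
qed

lemma convex_on_gradient_le:
  fixes f :: "real ^ 'd \<Rightarrow> real"
  assumes "convex_on X f" "GDERIV f y :> df y" "x \<in> X" "y \<in> X"
  shows "f y + df y \<bullet> (x - y) \<le> f x"
proof -
  have "strongly_convex_on norm 0 X f"
    using assms(1) unfolding strongly_convex_on_def convex_on_def by auto
  from strongly_convex_on_imp_bregman_ge[OF this, of y df x] assms(2-4) show ?thesis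
    by (simp add: bregman_def)
qed

text \<open>The segment from the minimizer \<open>p\<close> to \<open>z\<close> stays in the set, so the directional derivative
  along it cannot be negative.\<close>

lemma is_arg_min_convex_gradient_ge:
  fixes h :: "real ^ 'd \<Rightarrow> real"
  assumes min: "is_arg_min h (\<lambda>y. y \<in> X) p" and "convex X" and deriv: "GDERIV h p :> d" and z: "z \<in> X"
  shows "d \<bullet> (z - p) \<ge> 0"
proof (rule tendsto_lowerbound)
  show "((\<lambda>u. (h (p + u *\<^sub>R (z - p)) - h p) / u) \<longlongrightarrow> d \<bullet> (z - p)) (at_right 0)"
    by (rule GDERIV_directional_tendsto[OF deriv])
  show "\<forall>\<^sub>F u in at_right 0. 0 \<le> (h (p + u *\<^sub>R (z - p)) - h p) / u"
  proof (rule eventually_at_rightI[of 0 1])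
    fix u :: real assume u: "u \<in> {0<..<1}"
    have "p \<in> X" using min by (simp add: is_arg_min_def)
    then have "(1 - u) *\<^sub>R p + u *\<^sub>R z \<in> X" using u z \<open>convex X\<close> by (intro convexD) auto
    moreover have "(1 - u) *\<^sub>R p + u *\<^sub>R z = p + u *\<^sub>R (z - p)" by (simp add: algebra_simps)
    ultimately have "h p \<le> h (p + u *\<^sub>R (z - p))"
      using min by (auto simp: is_arg_min_def not_less)
    then show "0 \<le> (h (p + u *\<^sub>R (z - p)) - h p) / u" using u by simp
  qed simp
qed simp

lemma GDERIV_imp_continuous_on:
  fixes h :: "real ^ 'd \<Rightarrow> real"
  assumes "\<And>y. GDERIV h y :> dh y"
  shows "continuous_on UNIV h"
proof (intro continuous_at_imp_continuous_on ballI)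
  fix y
  show "isCont h y"
    using assms[of y] unfolding gderiv_def by (rule has_derivative_continuous)
qed

text \<open>A gradient that exists everywhere is a pointwise limit of continuous difference quotients,
  even if it is not continuous itself.\<close>

lemma GDERIV_imp_borel_measurable_gradient:
  fixes h :: "real ^ 'd \<Rightarrow> real"
  assumes deriv: "\<And>y. GDERIV h y :> dh y"
  shows "dh \<in> borel_measurable borel"
proof (rule borel_measurable_euclidean_space[THEN iffD2], intro ballI)
  have [measurable]: "h \<in> borel_measurable borel"
    by (intro borel_measurable_continuous_onI GDERIV_imp_continuous_on[OF deriv])
  fix v :: "real ^ 'd"
  show "(\<lambda>y. dh y \<bullet> v) \<in> borel_measurable borel"
  proof (rule borel_measurable_LIMSEQ_real)
    fix y :: "real ^ 'd"
    have "filterlim (\<lambda>n. inverse (real (Suc n))) (at_right 0) sequentially"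
      by (intro tendsto_imp_filterlim_at_right LIMSEQ_inverse_real_of_nat) simp
    from filterlim_compose[OF GDERIV_directional_tendsto[OF deriv] this]
    show "(\<lambda>n. (h (y + inverse (real (Suc n)) *\<^sub>R v) - h y) / inverse (real (Suc n)))
        \<longlonglongrightarrow> dh y \<bullet> v" .
  qed measurable
qed

section \<open>One step of mirror descent\<close>

lemma bregman_three_point:
  "bregman \<psi> d\<psi> z p - bregman \<psi> d\<psi> z q - bregman \<psi> d\<psi> q p = (d\<psi> q - d\<psi> p) \<bullet> (z - q)"
  by (simp add: bregman_def inner_diff_left inner_diff_right)

lemma mirror_step_optimality:
  fixes \<psi> :: "real ^ 'd \<Rightarrow> real"
  assumes "convex X" and deriv: "GDERIV \<psi> q :> d\<psi> q"
    and min: "is_arg_min (\<lambda>y. w \<bullet> y + \<psi> y) (\<lambda>y. y \<in> X) q" and z: "z \<in> X"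
  shows "(w + d\<psi> q) \<bullet> (z - q) \<ge> 0"
proof (rule is_arg_min_convex_gradient_ge[OF min \<open>convex X\<close> _ z])
  have "(\<psi> has_derivative (\<lambda>k. k \<bullet> d\<psi> q)) (at q)" using deriv by (simp add: gderiv_def)
  then show "GDERIV (\<lambda>y. w \<bullet> y + \<psi> y) q :> w + d\<psi> q"
    unfolding gderiv_def
    by (auto intro!: derivative_eq_intros simp: inner_add_right inner_commute)
qed

text \<open>Up to a constant, the objective of a mirror step depends on the gradient and on the
  current iterate only through the vector \<open>e g - \<nabla>\<psi>(p)\<close>.\<close>

lemma mirror_step_objective:
  "is_arg_min (\<lambda>y. e * (v \<bullet> y) + bregman \<psi> d\<psi> y p) (\<lambda>y. y \<in> X) q
    \<longleftrightarrow> is_arg_min (\<lambda>y. (e *\<^sub>R v - d\<psi> p) \<bullet> y + \<psi> y) (\<lambda>y. y \<in> X) q"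
proof -
  have "e * (v \<bullet> y) + bregman \<psi> d\<psi> y p = (e *\<^sub>R v - d\<psi> p) \<bullet> y + \<psi> y + (d\<psi> p \<bullet> p - \<psi> p)" for y
    by (simp add: bregman_def algebra_simps inner_diff_left inner_diff_right)
  then show ?thesis by (simp add: is_arg_min_def)
qed

text \<open>The optimality condition is tested at \<open>z\<close> and rewritten by the three-point identity. The
  term \<open>e g \<bullet> (p - q)\<close> left over from evaluating the gradient at \<open>p\<close> instead of \<open>q\<close> is split by
  Young's inequality, and strong convexity absorbs its quadratic part.\<close>

lemma mirror_step_le:
  fixes \<psi> :: "real ^ 'd \<Rightarrow> real"
  assumes N: "is_norm N" and "convex X" and deriv: "\<And>y. GDERIV \<psi> y :> d\<psi> y"
    and sc: "strongly_convex_on N 1 X \<psi>" and p: "p \<in> X" and z: "z \<in> X"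
    and min: "is_arg_min (\<lambda>y. e * (v \<bullet> y) + bregman \<psi> d\<psi> y p) (\<lambda>y. y \<in> X) q"
  shows "e * (v \<bullet> (p - z)) \<le> bregman \<psi> d\<psi> z p - bregman \<psi> d\<psi> z q + e\<^sup>2 * (dual_norm N v)\<^sup>2 / 2"
proof -
  have q: "q \<in> X" using min by (simp add: is_arg_min_def)
  have "(e *\<^sub>R v - d\<psi> p + d\<psi> q) \<bullet> (z - q) \<ge> 0"
    using min mirror_step_optimality[where d\<psi> = d\<psi>, OF \<open>convex X\<close> deriv _ z] by (simp add: mirror_step_objective)
  then have opt: "e * (v \<bullet> (q - z)) \<le> (d\<psi> q - d\<psi> p) \<bullet> (z - q)"
    by (simp add: algebra_simps inner_diff_left inner_diff_right)
  have "(N (q - p))\<^sup>2 / 2 \<le> bregman \<psi> d\<psi> q p"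
    using strongly_convex_on_imp_bregman_ge[OF sc, of p d\<psi> q] deriv p q by simp
  moreover have "e * (v \<bullet> (p - q)) \<le> e\<^sup>2 * (dual_norm N v)\<^sup>2 / 2 + (N (q - p))\<^sup>2 / 2"
  proof -
    have "e * (v \<bullet> (p - q)) \<le> \<bar>e\<bar> * \<bar>v \<bullet> (p - q)\<bar>"
      by (metis abs_ge_self abs_mult)
    also have "\<dots> \<le> \<bar>e\<bar> * (dual_norm N v * N (q - p))"
      using abs_inner_le_dual_norm[OF N, of v "p - q"]
      by (simp add: mult_left_mono is_norm_minus_commute[OF N])
    also have "\<dots> \<le> e\<^sup>2 * (dual_norm N v)\<^sup>2 / 2 + (N (q - p))\<^sup>2 / 2"
      using zero_le_power2[of "\<bar>e\<bar> * dual_norm N v - N (q - p)"]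
      by (simp add: power2_diff power_mult_distrib)
    finally show ?thesis .
  qed
  moreover have "e * (v \<bullet> (p - z)) = e * (v \<bullet> (p - q)) + e * (v \<bullet> (q - z))"
    by (simp add: inner_diff_right algebra_simps)
  ultimately show ?thesis
    using opt bregman_three_point[of \<psi> d\<psi> z p q] by linarith
qed

text \<open>The stochastic gradient is split into the true gradient, which is handled by convexity,
  and the noise.\<close>

lemma stochastic_mirror_step_descent:
  fixes f \<psi> :: "real ^ 'd \<Rightarrow> real"
  assumes N: "is_norm N" and "convex X" and deriv: "\<And>y. GDERIV \<psi> y :> d\<psi> y"
    and sc: "strongly_convex_on N 1 X \<psi>" and p: "p \<in> X" and z: "z \<in> X"
    and f: "convex_on X f" "GDERIV f p :> df p" and G: "dual_norm N (df p) \<le> G"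
    and "0 \<le> e" and min: "is_arg_min (\<lambda>y. e * (v \<bullet> y) + bregman \<psi> d\<psi> y p) (\<lambda>y. y \<in> X) q"
  shows "e * (f p - f z) \<le> bregman \<psi> d\<psi> z p - bregman \<psi> d\<psi> z q
      + e * ((v - df p) \<bullet> (z - p)) + e\<^sup>2 * (G\<^sup>2 + (dual_norm N (v - df p))\<^sup>2)"
proof -
  let ?\<xi> = "v - df p"
  have "f p - f z \<le> df p \<bullet> (p - z)"
    using convex_on_gradient_le[OF f(1), of p df z] f(2) p z by (simp add: inner_diff_right)
  then have "f p - f z \<le> v \<bullet> (p - z) + ?\<xi> \<bullet> (z - p)"
    by (simp add: inner_diff_left inner_diff_right)
  then have "e * (f p - f z) \<le> e * (v \<bullet> (p - z)) + e * (?\<xi> \<bullet> (z - p))"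
    using \<open>0 \<le> e\<close> by (metis distrib_left mult_left_mono)
  moreover have "(dual_norm N v)\<^sup>2 / 2 \<le> G\<^sup>2 + (dual_norm N ?\<xi>)\<^sup>2"
  proof -
    have "dual_norm N v \<le> G + dual_norm N ?\<xi>"
      using is_norm_triangle[OF is_norm_dual_norm[OF N], of "df p" ?\<xi>] G by simp
    then have "(dual_norm N v)\<^sup>2 \<le> (G + dual_norm N ?\<xi>)\<^sup>2"
      by (intro power_mono dual_norm_nonneg[OF N])
    also have "\<dots> \<le> 2 * (G\<^sup>2 + (dual_norm N ?\<xi>)\<^sup>2)"
      using zero_le_power2[of "G - dual_norm N ?\<xi>"] by (simp add: power2_sum power2_diff)
    finally show ?thesis by simp
  qed
  then have "e\<^sup>2 * ((dual_norm N v)\<^sup>2 / 2) \<le> e\<^sup>2 * (G\<^sup>2 + (dual_norm N ?\<xi>)\<^sup>2)"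
    by (rule mult_left_mono) simp
  ultimately show ?thesis
    using mirror_step_le[OF N \<open>convex X\<close> deriv sc p z min] by simp
qed

text \<open>Adding the optimality conditions of two steps and using strong monotonicity of
  \<open>\<nabla>\<psi>\<close>, which is strong convexity applied in both directions.\<close>

lemma mirror_step_Lipschitz:
  fixes \<psi> :: "real ^ 'd \<Rightarrow> real"
  assumes N: "is_norm N" and "convex X" and deriv: "\<And>y. GDERIV \<psi> y :> d\<psi> y"
    and sc: "strongly_convex_on N 1 X \<psi>"
    and min: "is_arg_min (\<lambda>y. w \<bullet> y + \<psi> y) (\<lambda>y. y \<in> X) q"
    and min': "is_arg_min (\<lambda>y. w' \<bullet> y + \<psi> y) (\<lambda>y. y \<in> X) q'"
  shows "N (q - q') \<le> dual_norm N (w - w')"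
proof (cases "N (q - q') = 0")
  case True
  then show ?thesis by (simp add: dual_norm_nonneg[OF N])
next
  case False
  then have pos: "N (q - q') > 0" using is_norm_nonneg[OF N, of "q - q'"] by linarith
  have q: "q \<in> X" and q': "q' \<in> X" using min min' by (simp_all add: is_arg_min_def)
  have "N (q - q') * N (q - q') \<le> bregman \<psi> d\<psi> q q' + bregman \<psi> d\<psi> q' q"
    using strongly_convex_on_imp_bregman_ge[OF sc, of q' d\<psi> q]
      strongly_convex_on_imp_bregman_ge[OF sc, of q d\<psi> q'] deriv q q'
    by (simp add: is_norm_minus_commute[OF N, of q' q] power2_eq_square)
  also have "\<dots> = (d\<psi> q' - d\<psi> q) \<bullet> (q' - q)"
    by (simp add: bregman_def inner_diff_left inner_diff_right)
  also have "\<dots> \<le> (w - w') \<bullet> (q' - q)"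
    using mirror_step_optimality[where d\<psi>=d\<psi>, OF \<open>convex X\<close> deriv min q']
      mirror_step_optimality[where d\<psi>=d\<psi>, OF \<open>convex X\<close> deriv min' q]
    by (simp add: inner_diff_left inner_diff_right inner_add_left)
  also have "\<dots> \<le> dual_norm N (w - w') * N (q - q')"
    using inner_le_dual_norm[OF N, of "w - w'" "q' - q"]
    by (simp add: is_norm_minus_commute[OF N, of q' q])
  finally show ?thesis using pos by simp
qed

text \<open>A mirror step is a continuous map on the set \<open>S\<close> of vectors for which a minimizer exists.
  This set need not be Borel, but that is harmless: the input takes values in \<open>S\<close>, so the
  restriction of the Borel algebra to \<open>S\<close> suffices.\<close>

lemma mirror_step_measurable:
  fixes \<psi> :: "real ^ 'd \<Rightarrow> real"
  assumes N: "is_norm N" and "convex X" and deriv: "\<And>y. GDERIV \<psi> y :> d\<psi> y"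
    and sc: "strongly_convex_on N 1 X \<psi>"
    and w: "w \<in> borel_measurable F"
    and min: "\<And>\<omega>. \<omega> \<in> space F \<Longrightarrow> is_arg_min (\<lambda>y. w \<omega> \<bullet> y + \<psi> y) (\<lambda>y. y \<in> X) (q \<omega>)"
  shows "q \<in> borel_measurable F"
proof -
  let ?min = "\<lambda>v. is_arg_min (\<lambda>y. v \<bullet> y + \<psi> y) (\<lambda>y. y \<in> X)"
  define S where "S = {v. \<exists>y. ?min v y}"
  define \<Phi> where "\<Phi> v = (SOME y. ?min v y)" for v
  have \<Phi>: "?min v (\<Phi> v)" if "v \<in> S" for v
    using that unfolding S_def \<Phi>_def by (auto intro: someI)
  note lipschitz = mirror_step_Lipschitz[where d\<psi>=d\<psi>, OF N \<open>convex X\<close> deriv sc]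
  obtain c where c: "c > 0" "\<And>x. c * norm x \<le> N x" using is_norm_ge_norm[OF N] by blast
  have "continuous_on S \<Phi>"
    unfolding continuous_on_def
  proof
    fix v assume v: "v \<in> S"
    have "((\<lambda>u. dual_norm N (u - v) / c) \<longlongrightarrow> dual_norm N (v - v) / c) (at v within S)"
      using c(1)
      by (intro tendsto_intros
          continuous_on_tendsto_compose[OF is_norm_continuous[OF is_norm_dual_norm[OF N]]]) auto
    moreover have "dual_norm N (v - v) / c = 0"
      using is_norm_eq_0_iff[OF is_norm_dual_norm[OF N], of 0] by simp
    ultimately have lim: "((\<lambda>u. dual_norm N (u - v) / c) \<longlongrightarrow> 0) (at v within S)"
      by (simp only:)
    have "norm (\<Phi> u - \<Phi> v) \<le> dual_norm N (u - v) / c" if "u \<in> S" for u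
    proof -
      have "c * norm (\<Phi> u - \<Phi> v) \<le> dual_norm N (u - v)"
        using c(2)[of "\<Phi> u - \<Phi> v"] lipschitz[OF \<Phi>[OF that] \<Phi>[OF v]] by linarith
      then show ?thesis using c(1) by (simp add: field_simps)
    qed
    then have "\<forall>\<^sub>F u in at v within S. norm (\<Phi> u - \<Phi> v) \<le> dual_norm N (u - v) / c"
      by (simp add: eventually_at_filter)
    from Lim_null_comparison[OF this lim] show "(\<Phi> \<longlongrightarrow> \<Phi> v) (at v within S)"
      by (simp add: LIM_zero_iff)
  qed
  then have "\<Phi> \<in> borel_measurable (restrict_space borel S)"
    by (rule borel_measurable_continuous_on_restrict)
  moreover have "w \<in> F \<rightarrow>\<^sub>M restrict_space borel S"
    using min w by (intro measurable_restrict_space2) (auto simp: S_def)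
  ultimately have "(\<lambda>\<omega>. \<Phi> (w \<omega>)) \<in> borel_measurable F"
    by (rule measurable_compose[rotated])
  moreover have "\<Phi> (w \<omega>) = q \<omega>" if "\<omega> \<in> space F" for \<omega>
  proof -
    have "N (\<Phi> (w \<omega>) - q \<omega>) \<le> dual_norm N (w \<omega> - w \<omega>)"
      using min[OF that] by (intro lipschitz \<Phi>) (auto simp: S_def)
    then show ?thesis
      using is_norm_nonneg[OF N] is_norm_eq_0_iff[OF N, of "\<Phi> (w \<omega>) - q \<omega>"]
        is_norm_eq_0_iff[OF is_norm_dual_norm[OF N], of 0]
      by (simp add: order_antisym)
  qed
  ultimately show ?thesis by (simp cong: measurable_cong)
qed

section \<open>The history of the noise\<close>

lemma space_history [simp]: "space (history M \<xi> t) = space M"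
  and sets_history: "sets (history M \<xi> t) = sigma_sets (space M)
      {\<xi> s -` A \<inter> space M | s A. s \<in> {1..<t} \<and> A \<in> sets borel}"
proof -
  have "{\<xi> s -` A \<inter> space M | s A. s \<in> {1..<t} \<and> A \<in> sets borel} \<subseteq> Pow (space M)" by auto
  then show "space (history M \<xi> t) = space M" "sets (history M \<xi> t) = sigma_sets (space M)
      {\<xi> s -` A \<inter> space M | s A. s \<in> {1..<t} \<and> A \<in> sets borel}"
    by (auto simp: history_def)
qed

lemma noise_measurable_history:
  assumes "1 \<le> s" "s < t"
  shows "\<xi> s \<in> borel_measurable (history M \<xi> t)"
  by (rule measurableI) (use assms in \<open>auto simp: sets_history\<close>)

lemma subalgebra_history:
  assumes "\<And>s. 1 \<le> s \<Longrightarrow> s < t \<Longrightarrow> \<xi> s \<in> borel_measurable M"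
  shows "subalgebra M (history M \<xi> t)"
  unfolding subalgebra_def sets_history
  using assms by (auto intro!: sets.sigma_sets_subset measurable_sets)

lemma sets_history_mono: "s \<le> t \<Longrightarrow> sets (history M \<xi> s) \<subseteq> sets (history M \<xi> t)"
  unfolding sets_history by (intro sigma_sets_mono') force

lemma measurable_history_mono:
  "h \<in> borel_measurable (history M \<xi> s) \<Longrightarrow> s \<le> t \<Longrightarrow> h \<in> borel_measurable (history M \<xi> t)"
  using sets_history_mono[of s t M \<xi>] by (auto simp: measurable_def)

section \<open>Exponential moments of sub-Gaussian noise\<close>

text \<open>For \<open>u < 0\<close> put \<open>y = - u\<close>: a quadratic lower bound for \<open>exp y\<close> turns into the upper bound
  \<open>1 - y + y\<^sup>2\<close> for \<open>exp (- y)\<close>.\<close>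

lemma exp_le_self_plus_exp_square: "exp u \<le> u + exp (u\<^sup>2)" for u :: real
proof -
  consider "u < 0" | "0 \<le> u" "u \<le> 1" | "1 < u" by linarith
  then show ?thesis
  proof cases
    case 1
    define y where "y = - u"
    have y: "0 \<le> y" using 1 by (simp add: y_def)
    have "1 \<le> (1 - y + y\<^sup>2) * (1 + y + y\<^sup>2 / 2)"
    proof -
      have "(1 - y + y\<^sup>2) * (1 + y + y\<^sup>2 / 2) = 1 + y\<^sup>2 / 2 + y ^ 3 / 2 + y ^ 4 / 2"
        by (simp add: field_simps power2_eq_square power3_eq_cube power4_eq_xxxx)
      then show ?thesis using y by simp
    qed
    also have "\<dots> \<le> (1 - y + y\<^sup>2) * exp y"
    proof (rule mult_left_mono)
      show "1 + y + y\<^sup>2 / 2 \<le> exp y" by (rule exp_lower_Taylor_quadratic[OF y])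
      show "0 \<le> 1 - y + y\<^sup>2"
        using zero_le_power2[of "y - 1"] y by (simp add: power2_diff)
    qed
    finally have "exp (- y) \<le> 1 - y + y\<^sup>2" by (simp add: exp_minus field_simps)
    then have "exp u \<le> 1 + u + u\<^sup>2" by (simp add: y_def)
    with exp_ge_add_one_self[of "u\<^sup>2"] show ?thesis by linarith
  next
    case 2
    then show ?thesis using exp_bound[of u] exp_ge_add_one_self[of "u\<^sup>2"] by linarith
  next
    case 3
    then have "u \<le> u\<^sup>2" by (simp add: power2_eq_square)
    then have "exp u \<le> exp (u\<^sup>2)" by simp
    then show ?thesis using 3 by linarith
  qed
qed

text \<open>With \<open>E = exp (u\<^sup>2)\<close> and \<open>Q = exp q\<close>, the previous bound gives
  \<open>exp (u + q) - u \<le> u (Q - 1) + E Q\<close>, where \<open>u \<le> E\<close>; and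
  \<open>E (Q - 1) + E Q \<le> (E Q)\<^sup>2\<close> because \<open>E\<close> and \<open>Q\<close> are at least 1.\<close>

lemma exp_add_le_self_plus_exp_square:
  fixes u q :: real
  assumes "0 \<le> q"
  shows "exp (u + q) \<le> u + exp (2 * (u\<^sup>2 + q))"
proof -
  let ?E = "exp (u\<^sup>2)" and ?Q = "exp q"
  have E: "1 \<le> ?E" and Q: "1 \<le> ?Q" using assms by simp_all
  have "u \<le> 1 + u\<^sup>2"
    using zero_le_power2[of "u - 1 / 2"] by (simp add: power2_diff power_divide)
  with exp_ge_add_one_self[of "u\<^sup>2"] have "u \<le> ?E" by linarith
  have "exp (u + q) \<le> (u + ?E) * ?Q"
    unfolding exp_add by (intro mult_right_mono exp_le_self_plus_exp_square) simp
  also have "\<dots> = u + (u * (?Q - 1) + ?E * ?Q)" by (simp add: algebra_simps)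
  also have "u * (?Q - 1) \<le> ?E * (?Q - 1)"
    using \<open>u \<le> ?E\<close> Q by (intro mult_right_mono) auto
  also have "?E * (?Q - 1) + ?E * ?Q \<le> (?E * ?Q) * (?E * ?Q)"
  proof -
    have "?E * ?Q - ?E \<le> (?E * ?Q) * (?E * ?Q) - ?E * ?Q"
    proof -
      have "?E * (?Q - 1) \<le> ?E * (?Q * (?E * ?Q - 1))"
      proof (rule mult_left_mono)
        have "?Q - 1 \<le> 1 * (?E * ?Q - 1)" using E Q by simp
        also have "\<dots> \<le> ?Q * (?E * ?Q - 1)"
        proof (rule mult_right_mono)
          show "0 \<le> ?E * ?Q - 1" using mult_mono[OF E Q] by simp
        qed (rule Q)
        finally show "?Q - 1 \<le> ?Q * (?E * ?Q - 1)" .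
      qed simp
      then show ?thesis by (simp add: algebra_simps)
    qed
    then show ?thesis by (simp add: algebra_simps)
  qed
  also have "(?E * ?Q) * (?E * ?Q) = exp (2 * (u\<^sup>2 + q))"
    by (simp flip: exp_add)
  finally show ?thesis by simp
qed

lemma exp_mult_le_chord:
  fixes \<theta> z :: real
  assumes "0 \<le> \<theta>" "\<theta> \<le> 1"
  shows "exp (\<theta> * z) \<le> 1 - \<theta> + \<theta> * exp z"
  using convex_onD[OF exp_convex assms, of 0 z] by simp

text \<open>The exponent for which the sub-Gaussian bound is used. The conditional moment is
  estimated in two regimes, because the linear term \<open>u\<close> can be split off at second order only if
  its coefficient \<open>n\<close> is at most of the order of \<open>1 / \<sigma>\<close>; otherwise it is absorbed by
  \<open>n Y \<le> n\<^sup>2 \<sigma>\<^sup>2 + Y\<^sup>2 / (4 \<sigma>\<^sup>2)\<close>.\<close>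

definition mgf_exponent :: "real \<Rightarrow> real \<Rightarrow> real \<Rightarrow> real" where
  "mgf_exponent \<sigma> r n = (if n \<le> 1 / (2 * \<sigma>) then 2 * (n\<^sup>2 + r) * \<sigma>\<^sup>2 else 1 / 4 + r * \<sigma>\<^sup>2)"

lemma mgf_exponent_range:
  assumes "\<sigma> > 0" "0 \<le> n" "0 \<le> r" "r \<le> 1 / (4 * \<sigma>\<^sup>2)"
  shows "0 \<le> mgf_exponent \<sigma> r n" "mgf_exponent \<sigma> r n \<le> 1"
proof -
  have r: "r * \<sigma>\<^sup>2 \<le> 1 / 4" using assms by (simp add: field_simps)
  show "0 \<le> mgf_exponent \<sigma> r n" using assms by (simp add: mgf_exponent_def)
  have n: "n\<^sup>2 * \<sigma>\<^sup>2 \<le> 1 / 4" if "n \<le> 1 / (2 * \<sigma>)"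
  proof -
    have "n * \<sigma> \<le> 1 / 2" using that assms by (simp add: field_simps)
    then have "(n * \<sigma>)\<^sup>2 \<le> (1 / 2)\<^sup>2" using assms by (intro power_mono) auto
    then show ?thesis by (simp add: power_mult_distrib power_divide)
  qed
  have "2 * (n\<^sup>2 + r) * \<sigma>\<^sup>2 \<le> 1" if "n \<le> 1 / (2 * \<sigma>)"
    using r n[OF that] by (simp add: distrib_right)
  then show "mgf_exponent \<sigma> r n \<le> 1"
    using r unfolding mgf_exponent_def by simp
qed

text \<open>The right-hand side is affine in \<open>exp (Y\<^sup>2 / \<sigma>\<^sup>2)\<close> and in \<open>u\<close>. A
  conditional expectation can therefore be taken termwise even if \<open>n\<close> is random: the sub-Gaussian
  bound at the single value \<open>\<lambda> = 1 / \<sigma>\<close> replaces the exponential by 1, and the affine factor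
  becomes \<open>1 - \<theta> + \<theta> = 1\<close>.\<close>

lemma exp_add_le_affine:
  fixes u Y n r \<sigma> :: real
  assumes "\<sigma> > 0" "0 \<le> n" "0 \<le> r" "r \<le> 1 / (4 * \<sigma>\<^sup>2)" and u: "\<bar>u\<bar> \<le> n * Y"
  defines "\<theta> \<equiv> mgf_exponent \<sigma> r n"
  shows "exp (u + r * Y\<^sup>2) \<le> (if n \<le> 1 / (2 * \<sigma>) then u else 0)
    + exp (3 * \<sigma>\<^sup>2 * (n\<^sup>2 + r)) * (1 - \<theta> + \<theta> * exp (Y\<^sup>2 / \<sigma>\<^sup>2 - 1))"
proof -
  let ?K = "1 - \<theta> + \<theta> * exp (Y\<^sup>2 / \<sigma>\<^sup>2 - 1)"
  have \<theta>: "0 \<le> \<theta>" "\<theta> \<le> 1" unfolding \<theta>_def by (intro mgf_exponent_range assms)+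
  have K: "exp (\<theta> * (Y\<^sup>2 / \<sigma>\<^sup>2 - 1)) \<le> ?K" by (rule exp_mult_le_chord[OF \<theta>])
  then have K0: "0 \<le> ?K" by (meson exp_ge_zero order_trans)
  have absorb: "exp b \<le> exp (3 * \<sigma>\<^sup>2 * (n\<^sup>2 + r)) * ?K"
    if "b \<le> c + \<theta> * (Y\<^sup>2 / \<sigma>\<^sup>2 - 1)" "c \<le> 3 * \<sigma>\<^sup>2 * (n\<^sup>2 + r)" for b c
  proof -
    have "exp b \<le> exp (3 * \<sigma>\<^sup>2 * (n\<^sup>2 + r)) * exp (\<theta> * (Y\<^sup>2 / \<sigma>\<^sup>2 - 1))"
      using that by (simp flip: exp_add)
    also have "\<dots> \<le> exp (3 * \<sigma>\<^sup>2 * (n\<^sup>2 + r)) * ?K" using K by (simp only: mult_left_mono exp_ge_zero)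
    finally show ?thesis .
  qed
  show ?thesis
  proof (cases "n \<le> 1 / (2 * \<sigma>)")
    case True
    have "u\<^sup>2 \<le> n\<^sup>2 * Y\<^sup>2"
      using power_mono[OF u abs_ge_zero, of 2] by (simp add: power_mult_distrib)
    then have "2 * (u\<^sup>2 + r * Y\<^sup>2) \<le> \<theta> + \<theta> * (Y\<^sup>2 / \<sigma>\<^sup>2 - 1)"
      using True assms(1) by (simp add: \<theta>_def mgf_exponent_def field_simps)
    moreover have "\<theta> \<le> 3 * \<sigma>\<^sup>2 * (n\<^sup>2 + r)"
      using True assms by (simp add: \<theta>_def mgf_exponent_def mult.commute[of _ "\<sigma>\<^sup>2"] mult_right_mono)
    ultimately have "exp (2 * (u\<^sup>2 + r * Y\<^sup>2)) \<le> exp (3 * \<sigma>\<^sup>2 * (n\<^sup>2 + r)) * ?K"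
      by (rule absorb)
    then show ?thesis
      using True exp_add_le_self_plus_exp_square[of "r * Y\<^sup>2" u] assms(3) by simp
  next
    case False
    have s1: "0 \<le> \<sigma> * n - 1 / 2" using False assms(1) by (simp add: field_simps)
    then have "(1 / 2)\<^sup>2 \<le> (\<sigma> * n)\<^sup>2" by (intro power_mono) auto
    then have s2: "1 / 4 \<le> \<sigma>\<^sup>2 * n\<^sup>2" by (simp add: power_mult_distrib power_divide)
    have "u \<le> n * Y" using u by linarith
    also have "\<dots> \<le> n\<^sup>2 * \<sigma>\<^sup>2 + Y\<^sup>2 / (4 * \<sigma>\<^sup>2)"
    proof -
      have "0 \<le> (n * \<sigma> - Y / (2 * \<sigma>))\<^sup>2" by simp
      then show ?thesis using assms(1) by (simp add: power2_diff power_mult_distrib power_divide)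
    qed
    finally have "u + r * Y\<^sup>2 \<le> (n\<^sup>2 * \<sigma>\<^sup>2 + \<theta>) + \<theta> * (Y\<^sup>2 / \<sigma>\<^sup>2 - 1)"
      using False assms(1) by (simp add: \<theta>_def mgf_exponent_def field_simps)
    moreover have "n\<^sup>2 * \<sigma>\<^sup>2 + \<theta> \<le> 3 * \<sigma>\<^sup>2 * (n\<^sup>2 + r)"
    proof -
      have "0 \<le> r * \<sigma>\<^sup>2" using assms by simp
      then show ?thesis
        using False s2 by (simp add: \<theta>_def mgf_exponent_def algebra_simps)
    qed
    ultimately have "exp (u + r * Y\<^sup>2) \<le> exp (3 * \<sigma>\<^sup>2 * (n\<^sup>2 + r)) * ?K"
      by (rule absorb)
    then show ?thesis using False by simp
  qed
qed

lemma borel_measurable_vec_component [measurable (raw)]: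
  fixes h :: "'a \<Rightarrow> real ^ 'd"
  shows "h \<in> borel_measurable M \<Longrightarrow> (\<lambda>\<omega>. h \<omega> $ i) \<in> borel_measurable M"
  by (rule measurable_compose[OF _ borel_measurable_nth])

text \<open>Boundedness of \<open>H * norm a\<close> makes the term that is linear in the noise integrable, and its
  integral then vanishes since the noise has conditional mean zero.\<close>

lemma nn_integral_exp_sub_gaussian_bounded:
  fixes N :: "real ^ 'd \<Rightarrow> real" and \<xi> a :: "'a \<Rightarrow> real ^ 'd"
  assumes "prob_space M" and sub: "subalgebra M F" and N: "is_norm N" and "\<sigma> > 0"
    and int: "integrable M \<xi>" and mean: "AE \<omega> in M. vec_cond_exp M F \<xi> \<omega> = 0"
    and sg: "cond_sub_gaussian M F \<sigma> (\<lambda>\<omega>. dual_norm N (\<xi> \<omega>))"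
    and a: "a \<in> borel_measurable F" and H: "H \<in> borel_measurable F"
    and H0: "\<And>\<omega>. 0 \<le> H \<omega>" and bounded: "\<And>\<omega>. H \<omega> * norm (a \<omega>) \<le> B"
    and r: "0 \<le> r" "r \<le> 1 / (4 * \<sigma>\<^sup>2)"
  shows "(\<integral>\<^sup>+\<omega>. ennreal (H \<omega> * exp (\<xi> \<omega> \<bullet> a \<omega> + r * (dual_norm N (\<xi> \<omega>))\<^sup>2)) \<partial>M)
    \<le> (\<integral>\<^sup>+\<omega>. ennreal (H \<omega> * exp (3 * \<sigma>\<^sup>2 * ((N (a \<omega>))\<^sup>2 + r))) \<partial>M)"
proof -
  interpret prob_space M by fact
  interpret finite_measure_subalgebra M F by unfold_locales (rule sub)
  have [measurable]: "N \<in> borel_measurable borel" "dual_norm N \<in> borel_measurable borel"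
    using N is_norm_dual_norm[OF N] by (auto intro: is_norm_borel)
  define \<theta> where "\<theta> \<omega> = mgf_exponent \<sigma> r (N (a \<omega>))" for \<omega>
  have \<theta>: "0 \<le> \<theta> \<omega>" "\<theta> \<omega> \<le> 1" for \<omega>
    unfolding \<theta>_def by (intro mgf_exponent_range is_norm_nonneg N r \<open>\<sigma> > 0\<close>)+
  define W where "W \<omega> = exp ((dual_norm N (\<xi> \<omega>))\<^sup>2 / \<sigma>\<^sup>2 - 1)" for \<omega>
  define A where "A \<omega> = (if N (a \<omega>) \<le> 1 / (2 * \<sigma>) then H \<omega> else 0)" for \<omega>
  define C where "C \<omega> = H \<omega> * exp (3 * \<sigma>\<^sup>2 * ((N (a \<omega>))\<^sup>2 + r))" for \<omega>
  have meas_F: "\<theta> \<in> borel_measurable F" "A \<in> borel_measurable F" "C \<in> borel_measurable F"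
    "(\<lambda>\<omega>. A \<omega> * a \<omega> $ i) \<in> borel_measurable F"
    "(\<lambda>\<omega>. ennreal (C \<omega> * \<theta> \<omega> * exp (- 1))) \<in> borel_measurable F" for i
  proof -
    note [measurable] = a H
    show [measurable]: "\<theta> \<in> borel_measurable F" "A \<in> borel_measurable F" "C \<in> borel_measurable F"
      unfolding \<theta>_def mgf_exponent_def A_def C_def by measurable
    show "(\<lambda>\<omega>. A \<omega> * a \<omega> $ i) \<in> borel_measurable F"
      "(\<lambda>\<omega>. ennreal (C \<omega> * \<theta> \<omega> * exp (- 1))) \<in> borel_measurable F"
      by measurable
  qed
  have [measurable]: "a \<in> borel_measurable M" "H \<in> borel_measurable M" "\<xi> \<in> borel_measurable M"
    "\<theta> \<in> borel_measurable M" "A \<in> borel_measurable M" "C \<in> borel_measurable M"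
    using measurable_from_subalg[OF sub] a H meas_F int by auto
  have [measurable]: "W \<in> borel_measurable M" unfolding W_def by measurable
  have C0: "0 \<le> C \<omega>" for \<omega> using H0 by (simp add: C_def)
  define U where "U \<omega> = A \<omega> * (\<xi> \<omega> \<bullet> a \<omega>)" for \<omega>
  define V where "V \<omega> = C \<omega> * (1 - \<theta> \<omega> + \<theta> \<omega> * W \<omega>)" for \<omega>
  have V0: "0 \<le> V \<omega>" for \<omega> using C0 \<theta> by (simp add: V_def W_def)
  let ?L = "\<lambda>\<omega>. H \<omega> * exp (\<xi> \<omega> \<bullet> a \<omega> + r * (dual_norm N (\<xi> \<omega>))\<^sup>2)"
  have pointwise: "?L \<omega> \<le> U \<omega> + V \<omega>" for \<omega>
  proof -
    have "\<bar>\<xi> \<omega> \<bullet> a \<omega>\<bar> \<le> N (a \<omega>) * dual_norm N (\<xi> \<omega>)"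
      using abs_inner_le_dual_norm[OF N] by (simp add: mult.commute)
    from mult_left_mono[OF exp_add_le_affine[OF \<open>\<sigma> > 0\<close> is_norm_nonneg[OF N] r this] H0[of \<omega>]]
    have "?L \<omega> \<le> H \<omega> * (if N (a \<omega>) \<le> 1 / (2 * \<sigma>) then \<xi> \<omega> \<bullet> a \<omega> else 0) + V \<omega>"
      unfolding V_def C_def \<theta>_def W_def by (simp only: distrib_left mult.assoc)
    also have "H \<omega> * (if N (a \<omega>) \<le> 1 / (2 * \<sigma>) then \<xi> \<omega> \<bullet> a \<omega> else 0) = U \<omega>"
      by (simp add: U_def A_def)
    finally show ?thesis .
  qed

  have U_int: "integrable M U" and U_0: "(\<integral>\<omega>. U \<omega> \<partial>M) = 0"
  proof -
    have Ui: "integrable M (\<lambda>\<omega>. (A \<omega> * a \<omega> $ i) * \<xi> \<omega> $ i)" for i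
    proof (rule Bochner_Integration.integrable_bound[OF integrable_mult_right[OF integrable_norm[OF int], of B]])
      show "AE \<omega> in M. norm ((A \<omega> * a \<omega> $ i) * \<xi> \<omega> $ i) \<le> norm (B * norm (\<xi> \<omega>))"
      proof (rule AE_I2)
        fix \<omega>
        have "\<bar>A \<omega> * a \<omega> $ i\<bar> \<le> H \<omega> * norm (a \<omega>)"
          using H0[of \<omega>] component_le_norm_cart[of "a \<omega>" i]
          by (auto simp: A_def abs_mult intro!: mult_mono)
        also note bounded[of \<omega>]
        finally have "\<bar>A \<omega> * a \<omega> $ i\<bar> \<le> \<bar>B\<bar>" by simp
        then have "\<bar>A \<omega> * a \<omega> $ i\<bar> * \<bar>\<xi> \<omega> $ i\<bar> \<le> \<bar>B\<bar> * norm (\<xi> \<omega>)"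
          by (intro mult_mono component_le_norm_cart) auto
        then show "norm ((A \<omega> * a \<omega> $ i) * \<xi> \<omega> $ i) \<le> norm (B * norm (\<xi> \<omega>))"
          by (simp add: abs_mult)
      qed
    qed measurable
    have zero: "(\<integral>\<omega>. (A \<omega> * a \<omega> $ i) * \<xi> \<omega> $ i \<partial>M) = 0" for i
    proof -
      have "(\<integral>\<omega>. (A \<omega> * a \<omega> $ i) * \<xi> \<omega> $ i \<partial>M)
          = (\<integral>\<omega>. (A \<omega> * a \<omega> $ i) * real_cond_exp M F (\<lambda>\<omega>. \<xi> \<omega> $ i) \<omega> \<partial>M)"
        by (rule real_cond_exp_intg(2)[OF Ui meas_F(4), symmetric]) measurable
      also have "\<dots> = (\<integral>\<omega>. 0 \<partial>M)"
      proof (rule integral_cong_AE)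
        show "AE \<omega> in M. (A \<omega> * a \<omega> $ i) * real_cond_exp M F (\<lambda>\<omega>. \<xi> \<omega> $ i) \<omega> = 0"
          using mean by eventually_elim (auto simp: vec_cond_exp_def vec_eq_iff)
      qed measurable
      finally show ?thesis by simp
    qed
    have "U = (\<lambda>\<omega>. \<Sum>i\<in>UNIV. (A \<omega> * a \<omega> $ i) * \<xi> \<omega> $ i)"
      by (auto simp: U_def inner_vec_def sum_distrib_left fun_eq_iff ac_simps)
    then show "integrable M U" "(\<integral>\<omega>. U \<omega> \<partial>M) = 0"
      using Ui zero by simp_all
  qed

  have W_cond: "AE \<omega> in M. nn_cond_exp M F (\<lambda>\<omega>. ennreal (exp ((dual_norm N (\<xi> \<omega>))\<^sup>2 / \<sigma>\<^sup>2))) \<omega> \<le> ennreal (exp 1)"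
  proof -
    have "AE \<omega> in M. nn_cond_exp M F (\<lambda>\<omega>. ennreal (exp ((1 / \<sigma>)\<^sup>2 * (dual_norm N (\<xi> \<omega>))\<^sup>2))) \<omega>
        \<le> ennreal (exp ((1 / \<sigma>)\<^sup>2 * \<sigma>\<^sup>2))"
      using sg \<open>\<sigma> > 0\<close> unfolding cond_sub_gaussian_def by simp
    then show ?thesis using \<open>\<sigma> > 0\<close> by (simp add: power_divide)
  qed
  have V_le: "(\<integral>\<^sup>+\<omega>. ennreal (V \<omega>) \<partial>M) \<le> (\<integral>\<^sup>+\<omega>. ennreal (C \<omega>) \<partial>M)"
  proof -
    let ?g = "\<lambda>\<omega>. ennreal (exp ((dual_norm N (\<xi> \<omega>))\<^sup>2 / \<sigma>\<^sup>2))"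
    let ?c = "\<lambda>\<omega>. ennreal (C \<omega> * \<theta> \<omega> * exp (- 1))"
    have "(\<integral>\<^sup>+\<omega>. ennreal (V \<omega>) \<partial>M)
        = (\<integral>\<^sup>+\<omega>. ennreal (C \<omega> * (1 - \<theta> \<omega>)) + ?c \<omega> * ?g \<omega> \<partial>M)"
    proof (rule nn_integral_cong)
      fix \<omega>
      have "V \<omega> = C \<omega> * (1 - \<theta> \<omega>) + C \<omega> * \<theta> \<omega> * exp (- 1) * exp ((dual_norm N (\<xi> \<omega>))\<^sup>2 / \<sigma>\<^sup>2)"
        by (simp add: V_def W_def algebra_simps flip: exp_add)
      then show "ennreal (V \<omega>) = ennreal (C \<omega> * (1 - \<theta> \<omega>)) + ?c \<omega> * ?g \<omega>"
        using C0[of \<omega>] \<theta>[of \<omega>] by (simp add: ennreal_plus ennreal_mult)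
    qed
    also have "\<dots> = (\<integral>\<^sup>+\<omega>. ennreal (C \<omega> * (1 - \<theta> \<omega>)) \<partial>M) + (\<integral>\<^sup>+\<omega>. ?c \<omega> * ?g \<omega> \<partial>M)"
      by (rule nn_integral_add) measurable
    also have "(\<integral>\<^sup>+\<omega>. ?c \<omega> * ?g \<omega> \<partial>M) = (\<integral>\<^sup>+\<omega>. ?c \<omega> * nn_cond_exp M F ?g \<omega> \<partial>M)"
      by (rule nn_cond_exp_intg[OF meas_F(5), symmetric]) measurable
    also have "\<dots> \<le> (\<integral>\<^sup>+\<omega>. ?c \<omega> * ennreal (exp 1) \<partial>M)"
      by (rule nn_integral_mono_AE) (use W_cond in \<open>eventually_elim, auto intro: mult_left_mono\<close>)
    also have "(\<integral>\<^sup>+\<omega>. ennreal (C \<omega> * (1 - \<theta> \<omega>)) \<partial>M) + (\<integral>\<^sup>+\<omega>. ?c \<omega> * ennreal (exp 1) \<partial>M)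
        = (\<integral>\<^sup>+\<omega>. ennreal (C \<omega> * (1 - \<theta> \<omega>)) + ?c \<omega> * ennreal (exp 1) \<partial>M)"
      by (rule nn_integral_add[symmetric]) measurable
    also have "\<dots> = (\<integral>\<^sup>+\<omega>. ennreal (C \<omega>) \<partial>M)"
    proof (rule nn_integral_cong)
      fix \<omega>
      have "C \<omega> = C \<omega> * (1 - \<theta> \<omega>) + C \<omega> * \<theta> \<omega> * exp (- 1) * exp 1"
        by (simp add: algebra_simps flip: exp_add)
      moreover have "ennreal (C \<omega> * (1 - \<theta> \<omega>) + C \<omega> * \<theta> \<omega> * exp (- 1) * exp 1)
          = ennreal (C \<omega> * (1 - \<theta> \<omega>)) + ?c \<omega> * ennreal (exp 1)"
        using C0[of \<omega>] \<theta>[of \<omega>] by (simp add: ennreal_plus ennreal_mult)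
      ultimately show "ennreal (C \<omega> * (1 - \<theta> \<omega>)) + ?c \<omega> * ennreal (exp 1) = ennreal (C \<omega>)"
        by simp
    qed
    finally show ?thesis by (simp add: add_left_mono)
  qed
  show ?thesis
  proof (cases "(\<integral>\<^sup>+\<omega>. ennreal (C \<omega>) \<partial>M) = \<infinity>")
    case True
    then show ?thesis by (simp add: C_def)
  next
    case False
    then have "(\<integral>\<^sup>+\<omega>. ennreal (V \<omega>) \<partial>M) < \<infinity>"
      using V_le by (metis infinity_ennreal_def less_top order_le_less_trans)
    moreover have [measurable]: "V \<in> borel_measurable M" unfolding V_def by measurable
    ultimately have V_int: "integrable M V"
      using V0 by (intro integrableI_nonneg) auto
    have "(\<integral>\<^sup>+\<omega>. ennreal (?L \<omega>) \<partial>M) \<le> (\<integral>\<^sup>+\<omega>. ennreal (U \<omega> + V \<omega>) \<partial>M)"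
      by (intro nn_integral_mono ennreal_leI pointwise)
    also have "\<dots> = ennreal (\<integral>\<omega>. U \<omega> + V \<omega> \<partial>M)"
    proof (rule nn_integral_eq_integral)
      show "AE \<omega> in M. 0 \<le> U \<omega> + V \<omega>"
        using H0 pointwise by (intro AE_I2) (meson exp_ge_zero mult_nonneg_nonneg order_trans)
    qed (use U_int V_int in simp)
    also have "(\<integral>\<omega>. U \<omega> + V \<omega> \<partial>M) = (\<integral>\<omega>. V \<omega> \<partial>M)"
      using U_int V_int U_0 by simp
    also have "ennreal \<dots> = (\<integral>\<^sup>+\<omega>. ennreal (V \<omega>) \<partial>M)"
      by (rule nn_integral_eq_integral[symmetric]) (use V_int V0 in auto)
    also note V_le
    finally show ?thesis by (simp add: C_def)
  qed
qed

text \<open>The boundedness hypothesis is removed by truncating \<open>H\<close>, which keeps it measurable with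
  respect to the conditioning algebra, and monotone convergence.\<close>

lemma nn_integral_exp_sub_gaussian:
  fixes N :: "real ^ 'd \<Rightarrow> real" and \<xi> a :: "'a \<Rightarrow> real ^ 'd"
  assumes "prob_space M" and sub: "subalgebra M F" and N: "is_norm N" and "\<sigma> > 0"
    and int: "integrable M \<xi>" and mean: "AE \<omega> in M. vec_cond_exp M F \<xi> \<omega> = 0"
    and sg: "cond_sub_gaussian M F \<sigma> (\<lambda>\<omega>. dual_norm N (\<xi> \<omega>))"
    and a: "a \<in> borel_measurable F" and H: "H \<in> borel_measurable F"
    and H0: "\<And>\<omega>. 0 \<le> H \<omega>" and r: "0 \<le> r" "r \<le> 1 / (4 * \<sigma>\<^sup>2)"
  shows "(\<integral>\<^sup>+\<omega>. ennreal (H \<omega> * exp (\<xi> \<omega> \<bullet> a \<omega> + r * (dual_norm N (\<xi> \<omega>))\<^sup>2)) \<partial>M)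
    \<le> (\<integral>\<^sup>+\<omega>. ennreal (H \<omega> * exp (3 * \<sigma>\<^sup>2 * ((N (a \<omega>))\<^sup>2 + r))) \<partial>M)"
proof -
  have [measurable]: "\<xi> \<in> borel_measurable M" using int by auto
  have [measurable]: "dual_norm N \<in> borel_measurable borel"
    using is_norm_dual_norm[OF N] by (rule is_norm_borel)
  have [measurable]: "a \<in> borel_measurable M" "H \<in> borel_measurable M"
    using measurable_from_subalg[OF sub a] measurable_from_subalg[OF sub H] by auto
  let ?E = "\<lambda>\<omega>. exp (\<xi> \<omega> \<bullet> a \<omega> + r * (dual_norm N (\<xi> \<omega>))\<^sup>2)"
  let ?R = "\<lambda>\<omega>. exp (3 * \<sigma>\<^sup>2 * ((N (a \<omega>))\<^sup>2 + r))"
  define K where "K n \<omega> = (if H \<omega> * norm (a \<omega>) \<le> real n then H \<omega> else 0)" for n \<omega>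
  have KF: "K n \<in> borel_measurable F" for n
  proof -
    note [measurable] = a H
    show ?thesis unfolding K_def by measurable
  qed
  have [measurable]: "K n \<in> borel_measurable M" for n unfolding K_def by measurable
  have K: "0 \<le> K n \<omega>" "K n \<omega> \<le> H \<omega>" "K n \<omega> * norm (a \<omega>) \<le> real n" for n \<omega>
    using H0[of \<omega>] by (auto simp: K_def)
  have "(\<integral>\<^sup>+\<omega>. ennreal (H \<omega> * ?E \<omega>) \<partial>M) \<le> (\<integral>\<^sup>+\<omega>. (SUP n. ennreal (K n \<omega> * ?E \<omega>)) \<partial>M)"
  proof (rule nn_integral_mono)
    fix \<omega>
    obtain n where "H \<omega> * norm (a \<omega>) \<le> real n" using real_arch_simple by blast
    then have "H \<omega> = K n \<omega>" by (simp add: K_def)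
    then show "ennreal (H \<omega> * ?E \<omega>) \<le> (SUP n. ennreal (K n \<omega> * ?E \<omega>))"
      by (auto intro!: SUP_upper2[of n])
  qed
  also have "\<dots> = (SUP n. \<integral>\<^sup>+\<omega>. ennreal (K n \<omega> * ?E \<omega>) \<partial>M)"
  proof (rule nn_integral_monotone_convergence_SUP)
    show "incseq (\<lambda>n \<omega>. ennreal (K n \<omega> * ?E \<omega>))"
      by (intro incseq_SucI le_funI ennreal_leI mult_right_mono) (use H0 in \<open>auto simp: K_def\<close>)
  qed measurable
  also have "\<dots> \<le> (\<integral>\<^sup>+\<omega>. ennreal (H \<omega> * ?R \<omega>) \<partial>M)"
  proof (rule SUP_least)
    fix n
    have "(\<integral>\<^sup>+\<omega>. ennreal (K n \<omega> * ?E \<omega>) \<partial>M) \<le> (\<integral>\<^sup>+\<omega>. ennreal (K n \<omega> * ?R \<omega>) \<partial>M)"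
      by (rule nn_integral_exp_sub_gaussian_bounded
          [OF \<open>prob_space M\<close> sub N \<open>\<sigma> > 0\<close> int mean sg a KF K(1) K(3) r])
    also have "\<dots> \<le> (\<integral>\<^sup>+\<omega>. ennreal (H \<omega> * ?R \<omega>) \<partial>M)"
      by (intro nn_integral_mono ennreal_leI mult_right_mono K) simp
    finally show "(\<integral>\<^sup>+\<omega>. ennreal (K n \<omega> * ?E \<omega>) \<partial>M) \<le> (\<integral>\<^sup>+\<omega>. ennreal (H \<omega> * ?R \<omega>) \<partial>M)" .
  qed
  finally show ?thesis .
qed

section \<open>Concentration along the trajectory\<close>

text \<open>The integrands form a nonnegative supermartingale with initial value 1.\<close>

lemma nn_integral_exp_sum_sub_gaussian_le_1:
  fixes N :: "real ^ 'd \<Rightarrow> real" and \<xi> a :: "nat \<Rightarrow> 'a \<Rightarrow> real ^ 'd"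
  assumes "prob_space M" and N: "is_norm N" and "\<sigma> > 0"
    and int: "\<And>t. 1 \<le> t \<Longrightarrow> t \<le> T \<Longrightarrow> integrable M (\<xi> t)"
    and mean: "\<And>t. 1 \<le> t \<Longrightarrow> t \<le> T \<Longrightarrow> AE \<omega> in M. vec_cond_exp M (history M \<xi> t) (\<xi> t) \<omega> = 0"
    and sg: "\<And>t. 1 \<le> t \<Longrightarrow> t \<le> T \<Longrightarrow>
      cond_sub_gaussian M (history M \<xi> t) \<sigma> (\<lambda>\<omega>. dual_norm N (\<xi> t \<omega>))"
    and a: "\<And>t. 1 \<le> t \<Longrightarrow> t \<le> T \<Longrightarrow> a t \<in> borel_measurable (history M \<xi> t)"
    and r: "\<And>t. 1 \<le> t \<Longrightarrow> t \<le> T \<Longrightarrow> 0 \<le> r t \<and> r t \<le> 1 / (4 * \<sigma>\<^sup>2)"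
    and "t \<le> T"
  shows "(\<integral>\<^sup>+\<omega>. ennreal (exp (\<Sum>s=1..t. \<xi> s \<omega> \<bullet> a s \<omega> + r s * (dual_norm N (\<xi> s \<omega>))\<^sup>2
      - 3 * \<sigma>\<^sup>2 * ((N (a s \<omega>))\<^sup>2 + r s))) \<partial>M) \<le> 1"
  using \<open>t \<le> T\<close>
proof (induction t)
  case 0
  interpret prob_space M by fact
  show ?case by (simp add: emeasure_space_1)
next
  case (Suc t)
  have [measurable]: "N \<in> borel_measurable borel" "dual_norm N \<in> borel_measurable borel"
    using N is_norm_dual_norm[OF N] by (auto intro: is_norm_borel)
  let ?F = "history M \<xi> (Suc t)"
  let ?c = "\<lambda>s \<omega>. 3 * \<sigma>\<^sup>2 * ((N (a s \<omega>))\<^sup>2 + r s)"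
  let ?Z = "\<lambda>s \<omega>. \<xi> s \<omega> \<bullet> a s \<omega> + r s * (dual_norm N (\<xi> s \<omega>))\<^sup>2 - ?c s \<omega>"
  define H where "H \<omega> = exp ((\<Sum>s=1..t. ?Z s \<omega>) - ?c (Suc t) \<omega>)" for \<omega>
  have sub: "subalgebra M ?F"
    using Suc.prems by (intro subalgebra_history borel_measurable_integrable int) auto
  have aF[measurable]: "a (Suc t) \<in> borel_measurable ?F" using Suc.prems by (intro a) auto
  have [measurable]: "?Z s \<in> borel_measurable ?F" if "s \<in> {1..t}" for s
  proof -
    have [measurable]: "\<xi> s \<in> borel_measurable ?F" "a s \<in> borel_measurable ?F"
      using that Suc.prems by (auto intro!: noise_measurable_history measurable_history_mono[OF a])
    show ?thesis by measurable
  qed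
  have HF: "H \<in> borel_measurable ?F" unfolding H_def by measurable
  have "(\<integral>\<^sup>+\<omega>. ennreal (exp (\<Sum>s=1..Suc t. ?Z s \<omega>)) \<partial>M) = (\<integral>\<^sup>+\<omega>. ennreal (H \<omega> *
      exp (\<xi> (Suc t) \<omega> \<bullet> a (Suc t) \<omega> + r (Suc t) * (dual_norm N (\<xi> (Suc t) \<omega>))\<^sup>2)) \<partial>M)"
    by (simp add: H_def algebra_simps flip: exp_add)
  also have "\<dots> \<le> (\<integral>\<^sup>+\<omega>. ennreal (H \<omega> * exp (?c (Suc t) \<omega>)) \<partial>M)"
    by (rule nn_integral_exp_sub_gaussian[OF \<open>prob_space M\<close> sub N \<open>\<sigma> > 0\<close> int mean sg aF HF])
       (use Suc.prems r[of "Suc t"] in \<open>auto simp: H_def\<close>)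
  also have "\<dots> = (\<integral>\<^sup>+\<omega>. ennreal (exp (\<Sum>s=1..t. ?Z s \<omega>)) \<partial>M)"
    by (simp add: H_def flip: exp_add)
  also have "\<dots> \<le> 1" using Suc by simp
  finally show ?case .
qed

text \<open>Markov's inequality for the final value of the supermartingale.\<close>

lemma sub_gaussian_sum_tail:
  fixes N :: "real ^ 'd \<Rightarrow> real" and \<xi> a :: "nat \<Rightarrow> 'a \<Rightarrow> real ^ 'd"
  assumes "prob_space M" and N: "is_norm N" and "\<sigma> > 0"
    and int: "\<And>t. 1 \<le> t \<Longrightarrow> t \<le> T \<Longrightarrow> integrable M (\<xi> t)"
    and mean: "\<And>t. 1 \<le> t \<Longrightarrow> t \<le> T \<Longrightarrow> AE \<omega> in M. vec_cond_exp M (history M \<xi> t) (\<xi> t) \<omega> = 0"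
    and sg: "\<And>t. 1 \<le> t \<Longrightarrow> t \<le> T \<Longrightarrow>
      cond_sub_gaussian M (history M \<xi> t) \<sigma> (\<lambda>\<omega>. dual_norm N (\<xi> t \<omega>))"
    and a: "\<And>t. 1 \<le> t \<Longrightarrow> t \<le> T \<Longrightarrow> a t \<in> borel_measurable (history M \<xi> t)"
    and r: "\<And>t. 1 \<le> t \<Longrightarrow> t \<le> T \<Longrightarrow> 0 \<le> r t \<and> r t \<le> 1 / (4 * \<sigma>\<^sup>2)"
    and \<delta>: "0 < \<delta>"
  shows "measure M {\<omega> \<in> space M. (\<Sum>t=1..T. \<xi> t \<omega> \<bullet> a t \<omega> + r t * (dual_norm N (\<xi> t \<omega>))\<^sup>2)
      \<le> ln (1 / \<delta>) + (\<Sum>t=1..T. 3 * \<sigma>\<^sup>2 * ((N (a t \<omega>))\<^sup>2 + r t))} \<ge> 1 - \<delta>" (is "measure M ?A \<ge> _")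
    and "{\<omega> \<in> space M. (\<Sum>t=1..T. \<xi> t \<omega> \<bullet> a t \<omega> + r t * (dual_norm N (\<xi> t \<omega>))\<^sup>2)
      \<le> ln (1 / \<delta>) + (\<Sum>t=1..T. 3 * \<sigma>\<^sup>2 * ((N (a t \<omega>))\<^sup>2 + r t))} \<in> sets M"
proof -
  interpret prob_space M by fact
  have [measurable]: "N \<in> borel_measurable borel" "dual_norm N \<in> borel_measurable borel"
    using N is_norm_dual_norm[OF N] by (auto intro: is_norm_borel)
  have \<xi>_meas: "\<xi> t \<in> borel_measurable M" if "1 \<le> t" "t \<le> T" for t
    using int[OF that] by (rule borel_measurable_integrable)
  have a_meas: "a t \<in> borel_measurable M" if "1 \<le> t" "t \<le> T" for t
    by (rule measurable_from_subalg[OF subalgebra_history a]) (use that \<xi>_meas in auto)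
  have [measurable]: "\<xi> t \<in> borel_measurable M" "a t \<in> borel_measurable M" if "t \<in> {1..T}" for t
    using that \<xi>_meas a_meas by auto
  show A: "?A \<in> sets M" by measurable
  let ?Z = "\<lambda>\<omega>. \<Sum>t=1..T. \<xi> t \<omega> \<bullet> a t \<omega> + r t * (dual_norm N (\<xi> t \<omega>))\<^sup>2
      - 3 * \<sigma>\<^sup>2 * ((N (a t \<omega>))\<^sup>2 + r t)"
  have Z[measurable]: "?Z \<in> borel_measurable M" by measurable
  have "space M - ?A \<subseteq> {\<omega> \<in> space M. 1 \<le> ennreal \<delta> * ennreal (exp (?Z \<omega>))}"
  proof
    fix \<omega> assume "\<omega> \<in> space M - ?A"
    then have \<omega>: "\<omega> \<in> space M" "ln (1 / \<delta>) < ?Z \<omega>" by (auto simp: sum_subtractf)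
    then have "exp (ln (1 / \<delta>)) < exp (?Z \<omega>)" by (simp only: exp_less_cancel_iff)
    then have "1 \<le> \<delta> * exp (?Z \<omega>)" using \<delta> by (simp add: field_simps)
    then show "\<omega> \<in> {\<omega> \<in> space M. 1 \<le> ennreal \<delta> * ennreal (exp (?Z \<omega>))}"
      using \<omega> \<delta> by (simp flip: ennreal_mult' ennreal_1)
  qed
  then have "emeasure M (space M - ?A) \<le> emeasure M {\<omega> \<in> space M. 1 \<le> ennreal \<delta> * ennreal (exp (?Z \<omega>))}"
    by (rule emeasure_mono) measurable
  also have "\<dots> \<le> ennreal \<delta> * (\<integral>\<^sup>+\<omega>. ennreal (exp (?Z \<omega>)) * indicator (space M) \<omega> \<partial>M)"
    by (rule nn_integral_Markov_inequality) measurable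
  also have "(\<integral>\<^sup>+\<omega>. ennreal (exp (?Z \<omega>)) * indicator (space M) \<omega> \<partial>M) = (\<integral>\<^sup>+\<omega>. ennreal (exp (?Z \<omega>)) \<partial>M)"
    by (intro nn_integral_cong) simp
  also have "\<dots> \<le> 1"
    by (rule nn_integral_exp_sum_sub_gaussian_le_1[OF \<open>prob_space M\<close> N \<open>\<sigma> > 0\<close> int mean sg a r order_refl])
  finally have "emeasure M (space M - ?A) \<le> ennreal \<delta>" by (simp add: mult_left_mono)
  then have "prob (space M - ?A) \<le> \<delta>" using \<delta> by (simp add: emeasure_eq_measure)
  then show "measure M ?A \<ge> 1 - \<delta>" using prob_compl[OF A] by simp
qed

section \<open>Weighted telescoping\<close>

text \<open>Weights \<open>w t\<close> that decrease fast enough to pay for the quadratic term of the noise: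
  \<open>w (t - 1) - w t = k \<eta>\<^sub>t\<^sup>2 w (t - 1) w t \<ge> k \<eta>\<^sub>t\<^sup>2 (w t)\<^sup>2\<close>. They lose only a factor 2 overall.\<close>

definition step_weight :: "real \<Rightarrow> (nat \<Rightarrow> real) \<Rightarrow> nat \<Rightarrow> nat \<Rightarrow> real" where
  "step_weight k \<eta> T t = 1 / (k * ((\<Sum>s=1..T. (\<eta> s)\<^sup>2) + (\<Sum>s=1..t. (\<eta> s)\<^sup>2)))"

lemma step_weight_bounds:
  assumes k: "k > 0" and S: "(\<Sum>s=1..T. (\<eta> s)\<^sup>2) > 0"
  shows "0 < step_weight k \<eta> T t"
    and "step_weight k \<eta> T t \<le> 1 / (k * (\<Sum>s=1..T. (\<eta> s)\<^sup>2))"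
    and "t \<le> T \<Longrightarrow> 1 / (2 * (k * (\<Sum>s=1..T. (\<eta> s)\<^sup>2))) \<le> step_weight k \<eta> T t"
proof -
  let ?S = "\<lambda>t. \<Sum>s=1..t. (\<eta> s)\<^sup>2"
  have nonneg: "0 \<le> ?S t" by (simp add: sum_nonneg)
  show "0 < step_weight k \<eta> T t"
    using k S nonneg by (simp add: step_weight_def)
  show "step_weight k \<eta> T t \<le> 1 / (k * ?S T)"
    unfolding step_weight_def using k S nonneg by (intro divide_left_mono) auto
  show "1 / (2 * (k * ?S T)) \<le> step_weight k \<eta> T t" if "t \<le> T"
  proof -
    have "?S t \<le> ?S T" by (rule sum_mono2) (use that in auto)
    then have "k * (?S T + ?S t) \<le> 2 * (k * ?S T)" using k by (simp add: algebra_simps)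
    then show ?thesis
      unfolding step_weight_def using k S nonneg by (intro divide_left_mono) auto
  qed
qed

lemma step_weight_decrease:
  assumes k: "k > 0" and S: "(\<Sum>s=1..T. (\<eta> s)\<^sup>2) > 0"
  shows "step_weight k \<eta> T (Suc t) + k * (\<eta> (Suc t))\<^sup>2 * (step_weight k \<eta> T (Suc t))\<^sup>2
    \<le> step_weight k \<eta> T t"
proof -
  define b where "b t = k * ((\<Sum>s=1..T. (\<eta> s)\<^sup>2) + (\<Sum>s=1..t. (\<eta> s)\<^sup>2))" for t
  have pos: "0 < b t" for t
    unfolding b_def using k S by (intro mult_pos_pos add_pos_nonneg sum_nonneg) auto
  have step: "b (Suc t) = b t + k * (\<eta> (Suc t))\<^sup>2" by (simp add: b_def algebra_simps)
  have "1 / b t - 1 / b (Suc t) = k * (\<eta> (Suc t))\<^sup>2 * (1 / b (Suc t) * (1 / b t))"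
    using pos[of t] pos[of "Suc t"] by (simp add: field_simps step)
  moreover have "1 / b (Suc t) \<le> 1 / b t"
    using pos[of t] pos[of "Suc t"] k step by (intro divide_left_mono) auto
  then have "1 / b (Suc t) * (1 / b (Suc t)) \<le> 1 / b (Suc t) * (1 / b t)"
    using pos[of "Suc t"] by (intro mult_left_mono) auto
  then have "k * (\<eta> (Suc t))\<^sup>2 * (1 / b (Suc t) * (1 / b (Suc t)))
      \<le> k * (\<eta> (Suc t))\<^sup>2 * (1 / b (Suc t) * (1 / b t))"
    by (rule mult_left_mono) (use k in simp)
  moreover have "step_weight k \<eta> T t = 1 / b t" for t
    by (simp only: step_weight_def b_def)
  ultimately show ?thesis
    by (simp only: power2_eq_square[of "1 / b (Suc t)"])
qed

text \<open>\<open>D t\<close> stands for the Bregman distance to the minimizer, \<open>d t\<close> for \<open>\<eta>\<^sub>t\<close> times the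
  suboptimality, \<open>m t\<close> and \<open>y t\<close> for the linear and quadratic noise terms, \<open>n t\<close> for the distance
  to the minimizer. The descent inequalities are multiplied by \<open>w t\<close> and added up: the noise bound
  leaves terms \<open>6 \<sigma>\<^sup>2 (w t)\<^sup>2 \<eta>\<^sub>t\<^sup>2 D t\<close>, which the telescoping sum cancels since the weights
  decrease.\<close>

lemma weighted_descent_bound:
  fixes D d m y n \<eta> :: "nat \<Rightarrow> real" and L \<sigma> G :: real
  assumes "\<sigma> > 0" and S: "(\<Sum>s=1..T. (\<eta> s)\<^sup>2) > 0"
  defines "w \<equiv> step_weight (6 * \<sigma>\<^sup>2) \<eta> T"
  assumes D0: "\<And>t. 1 \<le> t \<Longrightarrow> t \<le> Suc T \<Longrightarrow> 0 \<le> D t"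
    and nD: "\<And>t. 1 \<le> t \<Longrightarrow> t \<le> T \<Longrightarrow> (n t)\<^sup>2 \<le> 2 * D t"
    and d0: "\<And>t. 1 \<le> t \<Longrightarrow> t \<le> T \<Longrightarrow> 0 \<le> d t"
    and descent: "\<And>t. 1 \<le> t \<Longrightarrow> t \<le> T \<Longrightarrow> d t \<le> D t - D (Suc t) + m t + (\<eta> t)\<^sup>2 * (G\<^sup>2 + y t)"
    and noise: "(\<Sum>t=1..T. w t * m t + w t * (\<eta> t)\<^sup>2 * y t)
      \<le> L + (\<Sum>t=1..T. 3 * \<sigma>\<^sup>2 * ((w t * \<eta> t * n t)\<^sup>2 + w t * (\<eta> t)\<^sup>2))"
  shows "D (Suc T) + (\<Sum>t=1..T. d t)
    \<le> 2 * D 1 + (2 * G\<^sup>2 + 6 * \<sigma>\<^sup>2 + 12 * \<sigma>\<^sup>2 * L) * (\<Sum>t=1..T. (\<eta> t)\<^sup>2)"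
proof -
  define S where "S = (\<Sum>t=1..T. (\<eta> t)\<^sup>2)"
  define C where "C = 6 * \<sigma>\<^sup>2 * S"
  have k: "6 * \<sigma>\<^sup>2 > 0" using \<open>\<sigma> > 0\<close> by simp
  have C: "C > 0" using k assms(2) by (simp add: C_def S_def)
  have bounds: "0 < w t" "w t \<le> 1 / C" "t \<le> T \<Longrightarrow> 1 / (2 * C) \<le> w t" for t
    unfolding w_def C_def S_def by (intro step_weight_bounds k assms(2); assumption?)+
  have step: "w t * d t + (w t * D (Suc t) - w (t - 1) * D t)
      \<le> (w t * m t + w t * (\<eta> t)\<^sup>2 * y t) - 3 * \<sigma>\<^sup>2 * (w t * \<eta> t * n t)\<^sup>2 + w t * (\<eta> t)\<^sup>2 * G\<^sup>2"
    if t: "t \<in> {1..T}" for t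
  proof -
    have t': "1 \<le> t" "t \<le> T" using t by auto
    have "w t + 6 * \<sigma>\<^sup>2 * (\<eta> t)\<^sup>2 * (w t)\<^sup>2 \<le> w (t - 1)"
      using step_weight_decrease[OF k assms(2), of "t - 1"] t' by (simp add: w_def)
    then have "(w t + 6 * \<sigma>\<^sup>2 * (\<eta> t)\<^sup>2 * (w t)\<^sup>2) * D t \<le> w (t - 1) * D t"
      using D0 t' by (intro mult_right_mono) auto
    moreover have "3 * \<sigma>\<^sup>2 * (w t * \<eta> t)\<^sup>2 * (n t)\<^sup>2 \<le> 3 * \<sigma>\<^sup>2 * (w t * \<eta> t)\<^sup>2 * (2 * D t)"
      by (intro mult_left_mono nD t') simp
    moreover have "w t * d t \<le> w t * (D t - D (Suc t) + m t + (\<eta> t)\<^sup>2 * (G\<^sup>2 + y t))"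
      using bounds(1)[of t] by (intro mult_left_mono descent t') auto
    ultimately show ?thesis by (simp add: algebra_simps power_mult_distrib)
  qed
  have telescope: "(\<Sum>t=1..T. w t * D (Suc t) - w (t - 1) * D t) = w T * D (Suc T) - w 0 * D 1"
    by (induction T) auto
  have "(\<Sum>t=1..T. w t * d t) + (w T * D (Suc T) - w 0 * D 1)
      \<le> (\<Sum>t=1..T. w t * m t + w t * (\<eta> t)\<^sup>2 * y t) - (\<Sum>t=1..T. 3 * \<sigma>\<^sup>2 * (w t * \<eta> t * n t)\<^sup>2)
        + (\<Sum>t=1..T. w t * (\<eta> t)\<^sup>2 * G\<^sup>2)"
    using sum_mono[OF step] unfolding telescope[symmetric] by (simp only: sum.distrib sum_subtractf)
  also have "\<dots> \<le> L + (G\<^sup>2 + 3 * \<sigma>\<^sup>2) * (\<Sum>t=1..T. w t * (\<eta> t)\<^sup>2)"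
    using noise by (simp add: algebra_simps sum.distrib sum_distrib_left)
  also have "\<dots> \<le> L + (G\<^sup>2 + 3 * \<sigma>\<^sup>2) * (S / C)"
  proof -
    have "(\<Sum>t=1..T. w t * (\<eta> t)\<^sup>2) \<le> (\<Sum>t=1..T. 1 / C * (\<eta> t)\<^sup>2)"
      by (intro sum_mono mult_right_mono bounds(2)) simp
    then show ?thesis by (simp add: S_def sum_divide_distrib mult_left_mono)
  qed
  finally have upper: "(\<Sum>t=1..T. w t * d t) + w T * D (Suc T)
      \<le> w 0 * D 1 + L + (G\<^sup>2 + 3 * \<sigma>\<^sup>2) * (S / C)" by simp
  have "1 / (2 * C) * ((\<Sum>t=1..T. d t) + D (Suc T))
      = (\<Sum>t=1..T. 1 / (2 * C) * d t) + 1 / (2 * C) * D (Suc T)"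
    by (simp only: distrib_left sum_distrib_left)
  also have "\<dots> \<le> (\<Sum>t=1..T. w t * d t) + w T * D (Suc T)"
    using D0 d0 by (intro add_mono sum_mono mult_right_mono bounds(3)) auto
  also note upper
  also have "w 0 * D 1 \<le> 1 / C * D 1"
    using D0 by (intro mult_right_mono bounds(2)) auto
  finally have "2 * C * (1 / (2 * C) * ((\<Sum>t=1..T. d t) + D (Suc T)))
      \<le> 2 * C * (1 / C * D 1 + L + (G\<^sup>2 + 3 * \<sigma>\<^sup>2) * (S / C))"
    using C by (intro mult_left_mono) auto
  then have "(\<Sum>t=1..T. d t) + D (Suc T) \<le> 2 * D 1 + 2 * C * L + 2 * (G\<^sup>2 + 3 * \<sigma>\<^sup>2) * S"
    using C by (simp add: algebra_simps)
  then show ?thesis by (simp add: C_def S_def algebra_simps)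
qed

section \<open>The trajectory of stochastic mirror descent\<close>

locale stochastic_mirror_descent_run = prob_space M
  for M :: "'a measure" +
  fixes N :: "real ^ 'd \<Rightarrow> real"
    and X :: "(real ^ 'd) set"
    and f \<psi> :: "real ^ 'd \<Rightarrow> real"
    and df d\<psi> :: "real ^ 'd \<Rightarrow> real ^ 'd"
    and g x :: "nat \<Rightarrow> 'a \<Rightarrow> real ^ 'd"
    and x1 xstar :: "real ^ 'd"
    and \<eta> :: "nat \<Rightarrow> real"
    and G \<sigma> :: real
    and T :: nat
  assumes N: "is_norm N"
    and convex_X: "convex X"
    and f_convex: "convex_on X f" and f_deriv: "\<And>y. GDERIV f y :> df y"
    and f_Lipschitz: "\<And>y. y \<in> X \<Longrightarrow> dual_norm N (df y) \<le> G"
    and \<psi>_deriv: "\<And>y. GDERIV \<psi> y :> d\<psi> y" and \<psi>_convex: "strongly_convex_on N 1 X \<psi>"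
    and xstar: "is_arg_min f (\<lambda>y. y \<in> X) xstar"
    and x1: "x1 \<in> X"
    and \<sigma>: "\<sigma> > 0"
    and descent: "stochastic_mirror_descent M X \<psi> d\<psi> T \<eta> x1 g x"
    and noise_ass: "unbiased_sub_gaussian_oracle M N df \<sigma> T g x"
begin

abbreviation \<xi> :: "nat \<Rightarrow> 'a \<Rightarrow> real ^ 'd" where
  "\<xi> \<equiv> gradient_noise df g x"

lemma xstar_in: "xstar \<in> X"
  using xstar by (simp add: is_arg_min_def)

lemma f_xstar_le: "y \<in> X \<Longrightarrow> f xstar \<le> f y"
  using xstar by (auto simp: is_arg_min_def not_less)

lemma x_1: "\<omega> \<in> space M \<Longrightarrow> x 1 \<omega> = x1"
  using descent by (simp add: stochastic_mirror_descent_def)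

lemma x_Suc:
  assumes "1 \<le> t" "t \<le> T" "\<omega> \<in> space M"
  shows "is_arg_min (\<lambda>y. \<eta> t * (g t \<omega> \<bullet> y) + bregman \<psi> d\<psi> y (x t \<omega>)) (\<lambda>y. y \<in> X) (x (Suc t) \<omega>)"
  using descent assms by (simp add: stochastic_mirror_descent_def)

lemma x_in:
  assumes "1 \<le> t" "t \<le> Suc T" "\<omega> \<in> space M"
  shows "x t \<omega> \<in> X"
proof (cases "t = 1")
  case True
  then show ?thesis using x_1 x1 assms by simp
next
  case False
  then obtain s where "t = Suc s" "1 \<le> s" "s \<le> T" using assms by (cases t) auto
  then show ?thesis using x_Suc[of s \<omega>] assms by (simp add: is_arg_min_def)
qed

lemma noise:
  assumes "1 \<le> t" "t \<le> T"
  shows "integrable M (\<xi> t)"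
    and "AE \<omega> in M. vec_cond_exp M (history M \<xi> t) (\<xi> t) \<omega> = 0"
    and "cond_sub_gaussian M (history M \<xi> t) \<sigma> (\<lambda>\<omega>. dual_norm N (\<xi> t \<omega>))"
  using noise_ass assms by (auto simp: unbiased_sub_gaussian_oracle_def Let_def)

lemma df_borel: "df \<in> borel_measurable borel"
  and d\<psi>_borel: "d\<psi> \<in> borel_measurable borel"
  using f_deriv \<psi>_deriv by (auto intro: GDERIV_imp_borel_measurable_gradient)

text \<open>The iterate \<open>x t\<close> is determined by the first \<open>t - 1\<close> noise vectors, because a mirror step is
  a measurable function of the gradient and of the current iterate.\<close>

lemma x_measurable_history:
  assumes "1 \<le> t" "t \<le> Suc T"
  shows "x t \<in> borel_measurable (history M \<xi> t)"
  using assms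
proof (induction t)
  case 0
  then show ?case by simp
next
  case (Suc t)
  show ?case
  proof (cases "t = 0")
    case True
    have "x 1 \<in> borel_measurable (history M \<xi> 1)
        \<longleftrightarrow> (\<lambda>\<omega>. x1) \<in> borel_measurable (history M \<xi> 1)"
      by (intro measurable_cong x_1) (simp only: space_history)
    then have "x 1 \<in> borel_measurable (history M \<xi> 1)"
      by (simp only: borel_measurable_const)
    then show ?thesis using True by simp
  next
    case False
    have t: "1 \<le> t" "t \<le> T" using False Suc.prems by auto
    let ?F = "history M \<xi> (Suc t)"
    note [measurable] = df_borel d\<psi>_borel
    have [measurable]: "x t \<in> borel_measurable ?F"
      using t by (intro measurable_history_mono[OF Suc.IH le_SucI[OF order_refl]]) simp_all
    have [measurable]: "\<xi> t \<in> borel_measurable ?F"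
      by (rule noise_measurable_history[OF t(1) lessI])
    \<comment> \<open>The history contains the noise rather than the gradients returned by the oracle; the
      latter are recovered by adding the true gradient at the current iterate.\<close>
    have "(\<lambda>\<omega>. \<eta> t *\<^sub>R (\<xi> t \<omega> + df (x t \<omega>)) - d\<psi> (x t \<omega>)) \<in> borel_measurable ?F"
      by measurable
    then show ?thesis
    proof (rule mirror_step_measurable[where d\<psi> = d\<psi>, OF N convex_X \<psi>_deriv \<psi>_convex])
      fix \<omega> assume "\<omega> \<in> space ?F"
      then show "is_arg_min (\<lambda>y. (\<eta> t *\<^sub>R (\<xi> t \<omega> + df (x t \<omega>)) - d\<psi> (x t \<omega>)) \<bullet> y + \<psi> y)
          (\<lambda>y. y \<in> X) (x (Suc t) \<omega>)"
        using x_Suc[OF t, of \<omega>] by (simp add: mirror_step_objective gradient_noise_def)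
    qed
  qed
qed

lemma x_measurable:
  assumes "1 \<le> t" "t \<le> Suc T"
  shows "x t \<in> borel_measurable M"
  by (rule measurable_from_subalg[OF subalgebra_history x_measurable_history])
     (use assms noise(1) in auto)

lemma norm_power2_le_bregman: "y \<in> X \<Longrightarrow> z \<in> X \<Longrightarrow> (N (z - y))\<^sup>2 \<le> 2 * bregman \<psi> d\<psi> z y"
  using strongly_convex_on_imp_bregman_ge[OF \<psi>_convex, of y d\<psi> z] \<psi>_deriv by simp

lemma step_descent:
  assumes "1 \<le> t" "t \<le> T" "0 \<le> \<eta> t" "\<omega> \<in> space M"
  shows "\<eta> t * (f (x t \<omega>) - f xstar)
    \<le> bregman \<psi> d\<psi> xstar (x t \<omega>) - bregman \<psi> d\<psi> xstar (x (Suc t) \<omega>)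
      + \<eta> t * (\<xi> t \<omega> \<bullet> (xstar - x t \<omega>)) + (\<eta> t)\<^sup>2 * (G\<^sup>2 + (dual_norm N (\<xi> t \<omega>))\<^sup>2)"
  unfolding gradient_noise_def
  by (rule stochastic_mirror_step_descent[where d\<psi> = d\<psi> and df = df and f = f and X = X
        and p = "x t \<omega>", OF N convex_X \<psi>_deriv \<psi>_convex _ xstar_in f_convex f_deriv
        f_Lipschitz \<open>0 \<le> \<eta> t\<close> x_Suc])
     (use assms in \<open>auto intro: x_in\<close>)

text \<open>The concentration inequality is applied with the predictable direction
  \<open>a t = w t \<eta>\<^sub>t (x\<^sup>* - x t)\<close>. Its cost \<open>3 \<sigma>\<^sup>2 (N (a t))\<^sup>2\<close> is at most
  \<open>6 \<sigma>\<^sup>2 (w t)\<^sup>2 \<eta>\<^sub>t\<^sup>2 D t\<close>, exactly what the decrease of the weights pays for with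
  \<open>k = 6 \<sigma>\<^sup>2\<close>.\<close>

lemma high_probability_bound:
  assumes \<eta>0: "\<And>t. 1 \<le> t \<Longrightarrow> t \<le> T \<Longrightarrow> 0 \<le> \<eta> t" and S: "(\<Sum>t=1..T. (\<eta> t)\<^sup>2) > 0"
    and "0 < \<delta>"
  obtains B where "B \<in> sets M" "measure M B \<ge> 1 - \<delta>"
    "\<And>\<omega>. \<omega> \<in> B \<Longrightarrow>
      bregman \<psi> d\<psi> xstar (x (Suc T) \<omega>) + (\<Sum>t=1..T. \<eta> t * (f (x t \<omega>) - f xstar))
      \<le> 2 * bregman \<psi> d\<psi> xstar x1
        + (2 * G\<^sup>2 + 6 * \<sigma>\<^sup>2 + 12 * \<sigma>\<^sup>2 * ln (1 / \<delta>)) * (\<Sum>t=1..T. (\<eta> t)\<^sup>2)"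
proof -
  define w where "w = step_weight (6 * \<sigma>\<^sup>2) \<eta> T"
  define a where "a t \<omega> = (w t * \<eta> t) *\<^sub>R (xstar - x t \<omega>)" for t \<omega>
  define r where "r t = w t * (\<eta> t)\<^sup>2" for t
  have k: "6 * \<sigma>\<^sup>2 > 0" using \<sigma> by simp
  have a_meas: "a t \<in> borel_measurable (history M \<xi> t)" if "1 \<le> t" "t \<le> T" for t
  proof -
    have [measurable]: "x t \<in> borel_measurable (history M \<xi> t)"
      using that by (intro x_measurable_history) auto
    show ?thesis unfolding a_def by measurable
  qed
  have r_range: "0 \<le> r t \<and> r t \<le> 1 / (4 * \<sigma>\<^sup>2)" if "1 \<le> t" "t \<le> T" for t
  proof
    show "0 \<le> r t"
      using step_weight_bounds(1)[OF k S, of t] by (simp add: r_def w_def)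
    \<comment> \<open>The weights are at most \<open>1 / (6 \<sigma>\<^sup>2 \<Sum> \<eta>\<^sub>s\<^sup>2)\<close>, which keeps the coefficient of the squared
      noise within reach of the sub-Gaussian bound.\<close>
    have "(\<eta> t)\<^sup>2 \<le> (\<Sum>s=1..T. (\<eta> s)\<^sup>2)"
      by (rule member_le_sum[of t "{1..T}" "\<lambda>s. (\<eta> s)\<^sup>2"]) (use that in auto)
    then have "r t \<le> 1 / (6 * \<sigma>\<^sup>2 * (\<Sum>s=1..T. (\<eta> s)\<^sup>2)) * (\<Sum>s=1..T. (\<eta> s)\<^sup>2)"
      unfolding r_def w_def using k S
      by (intro mult_mono step_weight_bounds(2)) auto
    also have "\<dots> = 1 / (6 * \<sigma>\<^sup>2)" using S by simp
    also have "\<dots> \<le> 1 / (4 * \<sigma>\<^sup>2)" using \<sigma> by (simp add: field_simps)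
    finally show "r t \<le> 1 / (4 * \<sigma>\<^sup>2)" .
  qed
  let ?B = "{\<omega> \<in> space M. (\<Sum>t=1..T. \<xi> t \<omega> \<bullet> a t \<omega> + r t * (dual_norm N (\<xi> t \<omega>))\<^sup>2)
      \<le> ln (1 / \<delta>) + (\<Sum>t=1..T. 3 * \<sigma>\<^sup>2 * ((N (a t \<omega>))\<^sup>2 + r t))}"
  note tail = sub_gaussian_sum_tail[where M = M and N = N and \<xi> = \<xi> and a = a and r = r and T = T,
      OF prob_space_axioms N \<sigma> noise a_meas r_range \<open>0 < \<delta>\<close>]
  show thesis
  proof (rule that)
    show "?B \<in> sets M" "measure M ?B \<ge> 1 - \<delta>" by (rule tail; assumption)+
  next
    fix \<omega> assume B: "\<omega> \<in> ?B"
    then have \<omega>: "\<omega> \<in> space M" by simp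
    let ?D = "\<lambda>t. bregman \<psi> d\<psi> xstar (x t \<omega>)"
    have "?D (Suc T) + (\<Sum>t=1..T. \<eta> t * (f (x t \<omega>) - f xstar))
      \<le> 2 * ?D 1 + (2 * G\<^sup>2 + 6 * \<sigma>\<^sup>2 + 12 * \<sigma>\<^sup>2 * ln (1 / \<delta>)) * (\<Sum>t=1..T. (\<eta> t)\<^sup>2)"
    proof (rule weighted_descent_bound[where m = "\<lambda>t. \<eta> t * (\<xi> t \<omega> \<bullet> (xstar - x t \<omega>))"
          and y = "\<lambda>t. (dual_norm N (\<xi> t \<omega>))\<^sup>2" and n = "\<lambda>t. N (xstar - x t \<omega>)", OF \<sigma> S])
      fix t assume "1 \<le> t" "t \<le> Suc T"
      then show "0 \<le> ?D t"
        using norm_power2_le_bregman[OF x_in[OF _ _ \<omega>] xstar_in, of t] zero_le_power2[of "N (xstar - x t \<omega>)"]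
        by linarith
    next
      fix t assume t: "1 \<le> t" "t \<le> T"
      then show "(N (xstar - x t \<omega>))\<^sup>2 \<le> 2 * ?D t"
        by (intro norm_power2_le_bregman x_in \<omega> xstar_in) auto
      show "0 \<le> \<eta> t * (f (x t \<omega>) - f xstar)"
        using \<eta>0[OF t] f_xstar_le[OF x_in[OF _ _ \<omega>], of t] t by simp
      show "\<eta> t * (f (x t \<omega>) - f xstar) \<le> ?D t - ?D (Suc t)
          + \<eta> t * (\<xi> t \<omega> \<bullet> (xstar - x t \<omega>)) + (\<eta> t)\<^sup>2 * (G\<^sup>2 + (dual_norm N (\<xi> t \<omega>))\<^sup>2)"
        by (rule step_descent[OF t \<eta>0[OF t] \<omega>])
    next
      have "N (a t \<omega>) ^ 2 = (w t * \<eta> t * N (xstar - x t \<omega>))\<^sup>2" for t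
        by (simp add: a_def is_norm_scaleR[OF N] power_mult_distrib)
      then show "(\<Sum>t=1..T. step_weight (6 * \<sigma>\<^sup>2) \<eta> T t * (\<eta> t * (\<xi> t \<omega> \<bullet> (xstar - x t \<omega>)))
            + step_weight (6 * \<sigma>\<^sup>2) \<eta> T t * (\<eta> t)\<^sup>2 * (dual_norm N (\<xi> t \<omega>))\<^sup>2)
          \<le> ln (1 / \<delta>) + (\<Sum>t=1..T. 3 * \<sigma>\<^sup>2 * ((step_weight (6 * \<sigma>\<^sup>2) \<eta> T t * \<eta> t * N (xstar - x t \<omega>))\<^sup>2
            + step_weight (6 * \<sigma>\<^sup>2) \<eta> T t * (\<eta> t)\<^sup>2))"
        using B by (simp add: a_def r_def mult.assoc flip: w_def)
    qed
    then show "?D (Suc T) + (\<Sum>t=1..T. \<eta> t * (f (x t \<omega>) - f xstar))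
      \<le> 2 * bregman \<psi> d\<psi> xstar x1
        + (2 * G\<^sup>2 + 6 * \<sigma>\<^sup>2 + 12 * \<sigma>\<^sup>2 * ln (1 / \<delta>)) * (\<Sum>t=1..T. (\<eta> t)\<^sup>2)"
      using x_1[OF \<omega>] by simp
  qed
qed

text \<open>If the start is already the minimizer, the prescribed step sizes vanish and the iterates
  never move.\<close>

lemma stationary:
  assumes zero: "bregman \<psi> d\<psi> xstar x1 = 0" and \<eta>: "\<And>t. 1 \<le> t \<Longrightarrow> t \<le> T \<Longrightarrow> \<eta> t = 0"
    and "1 \<le> t" "t \<le> Suc T" and \<omega>: "\<omega> \<in> space M"
  shows "x t \<omega> = xstar"
proof -
  have eq: "y = xstar" if "y \<in> X" "bregman \<psi> d\<psi> xstar y \<le> 0" for y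
  proof -
    have "(N (xstar - y))\<^sup>2 \<le> 0" using norm_power2_le_bregman[OF that(1) xstar_in] that(2) by linarith
    then show ?thesis using is_norm_eq_0_iff[OF N, of "xstar - y"] by simp
  qed
  show ?thesis
    using \<open>1 \<le> t\<close> \<open>t \<le> Suc T\<close>
  proof (induction t rule: dec_induct)
    case base
    then show ?case using eq[OF x1] zero x_1[OF \<omega>] by simp
  next
    case (step t)
    have "bregman \<psi> d\<psi> xstar (x (Suc t) \<omega>) \<le> bregman \<psi> d\<psi> xstar (x t \<omega>)"
      using step_descent[of t \<omega>] \<eta>[of t] step \<omega> by simp
    also have "\<dots> = 0" using step by (simp add: bregman_def)
    finally show ?case using step by (intro eq x_in \<omega>) auto
  qed
qed

text \<open>Both step size schedules are of the form \<open>\<eta>\<^sub>t\<^sup>2 = D\<^sub>1 / (6 K c\<^sub>t)\<close> with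
  \<open>0 < c\<^sub>t \<le> T\<close>, namely \<open>c\<^sub>t = T\<close> and \<open>c\<^sub>t = t\<close>; then \<open>h\<close> is 1 and \<open>1 + ln T\<close> respectively. The
  constant 6 makes the noise and gradient terms add up to at most \<open>2 h D\<^sub>1\<close>.\<close>

lemma schedule_bound:
  fixes \<delta> h :: real and c :: "nat \<Rightarrow> real"
  defines "K \<equiv> G\<^sup>2 + \<sigma>\<^sup>2 * (1 + ln (1 / \<delta>))"
  assumes \<delta>: "0 < \<delta>" "\<delta> < 1" and "1 \<le> T"
    and \<eta>: "\<And>t. 1 \<le> t \<Longrightarrow> t \<le> T \<Longrightarrow> \<eta> t = sqrt (bregman \<psi> d\<psi> xstar x1 / (6 * K * c t))"
    and c: "\<And>t. 1 \<le> t \<Longrightarrow> t \<le> T \<Longrightarrow> 0 < c t \<and> c t \<le> real T"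
    and h: "(\<Sum>t=1..T. 1 / c t) \<le> h"
  shows "measure M {\<omega> \<in> space M.
      bregman \<psi> d\<psi> xstar (x (T + 1) \<omega>) \<le> 2 * (1 + h) * bregman \<psi> d\<psi> xstar x1 \<and>
      1 / real T * (\<Sum>t=1..T. f (x t \<omega>) - f xstar)
        \<le> 2 * sqrt 6 / sqrt (real T) * (1 + h) * sqrt (bregman \<psi> d\<psi> xstar x1 * K)} \<ge> 1 - \<delta>"
    (is "measure M ?A \<ge> _")
proof -
  define D where "D = bregman \<psi> d\<psi> xstar x1"
  have L: "ln (1 / \<delta>) > 0" using \<delta> by simp
  have K: "K > 0"
    unfolding K_def using \<sigma> L by (intro add_nonneg_pos mult_pos_pos) auto
  have D: "0 \<le> D"
    using norm_power2_le_bregman[OF x1 xstar_in] zero_le_power2[of "N (xstar - x1)"] unfolding D_def by linarith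
  have "0 \<le> (\<Sum>t=1..T. 1 / c t)"
    using c by (intro sum_nonneg) (auto intro: less_imp_le)
  then have h0: "0 \<le> h" using h by linarith
  note \<eta>D = \<eta>[folded D_def]
  have A_sets: "?A \<in> sets M"
  proof -
    have [measurable]: "x t \<in> borel_measurable M" if "t \<in> {1..T}" for t
      using that by (intro x_measurable) auto
    have [measurable]: "x (T + 1) \<in> borel_measurable M" by (intro x_measurable) auto
    have [measurable]: "f \<in> borel_measurable borel" "\<psi> \<in> borel_measurable borel"
      "d\<psi> \<in> borel_measurable borel"
      using f_deriv \<psi>_deriv d\<psi>_borel
      by (auto intro!: borel_measurable_continuous_onI intro: GDERIV_imp_continuous_on)
    show ?thesis unfolding bregman_def by measurable
  qed
  show ?thesis
  proof (cases "D = 0")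
    case True
    then have stay: "x t \<omega> = xstar" if "1 \<le> t" "t \<le> Suc T" "\<omega> \<in> space M" for t \<omega>
      using that \<eta>D by (intro stationary) (auto simp: D_def)
    have "bregman \<psi> d\<psi> xstar xstar = 0" by (simp add: bregman_def)
    then have "?A = space M"
      using stay True by (auto simp flip: D_def)
    then show ?thesis using \<delta> by (simp add: prob_space)
  next
    case False
    then have D: "D > 0" using D by simp
    have \<eta>_pos: "\<eta> t > 0" if "1 \<le> t" "t \<le> T" for t
      using \<eta>D[OF that] c[OF that] K D by simp
    have \<eta>_sq: "(\<eta> t)\<^sup>2 = D / (6 * K) * (1 / c t)" if "1 \<le> t" "t \<le> T" for t
      using \<eta>D[OF that] c[OF that] K D by simp
    have "(\<eta> t)\<^sup>2 > 0" if "t \<in> {1..T}" for t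
      using \<eta>_pos[of t] that by simp
    then have S: "(\<Sum>t=1..T. (\<eta> t)\<^sup>2) > 0"
      using \<open>1 \<le> T\<close> by (intro sum_pos) auto
    have "(\<Sum>t=1..T. (\<eta> t)\<^sup>2) = (\<Sum>t=1..T. D / (6 * K) * (1 / c t))"
      by (intro sum.cong) (auto simp: \<eta>_sq)
    then have S_le: "(\<Sum>t=1..T. (\<eta> t)\<^sup>2) \<le> D / (6 * K) * h"
      unfolding sum_distrib_left[symmetric] using mult_left_mono[OF h, of "D / (6 * K)"] D K by simp
    obtain B where B: "B \<in> sets M" "measure M B \<ge> 1 - \<delta>"
      and bound: "\<And>\<omega>. \<omega> \<in> B \<Longrightarrow>
        bregman \<psi> d\<psi> xstar (x (Suc T) \<omega>) + (\<Sum>t=1..T. \<eta> t * (f (x t \<omega>) - f xstar))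
        \<le> 2 * D + (2 * G\<^sup>2 + 6 * \<sigma>\<^sup>2 + 12 * \<sigma>\<^sup>2 * ln (1 / \<delta>)) * (\<Sum>t=1..T. (\<eta> t)\<^sup>2)"
      using high_probability_bound[OF less_imp_le[OF \<eta>_pos] S \<delta>(1)] unfolding D_def by blast
    have rhs: "2 * D + (2 * G\<^sup>2 + 6 * \<sigma>\<^sup>2 + 12 * \<sigma>\<^sup>2 * ln (1 / \<delta>)) * (\<Sum>t=1..T. (\<eta> t)\<^sup>2)
        \<le> 2 * (1 + h) * D"
    proof -
      have "2 * G\<^sup>2 + 6 * \<sigma>\<^sup>2 + 12 * \<sigma>\<^sup>2 * ln (1 / \<delta>) \<le> 12 * K"
        unfolding K_def by (simp add: algebra_simps)
      then have "(2 * G\<^sup>2 + 6 * \<sigma>\<^sup>2 + 12 * \<sigma>\<^sup>2 * ln (1 / \<delta>)) * (\<Sum>t=1..T. (\<eta> t)\<^sup>2)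
          \<le> 12 * K * (D / (6 * K) * h)"
        using S S_le K by (intro mult_mono) auto
      also have "\<dots> = 2 * h * D" using K by simp
      finally show ?thesis by (simp add: algebra_simps)
    qed
    have "B \<subseteq> ?A"
    proof
      fix \<omega> assume "\<omega> \<in> B"
      then have \<omega>: "\<omega> \<in> space M" using B(1) sets.sets_into_space by blast
      have bound_\<omega>: "bregman \<psi> d\<psi> xstar (x (Suc T) \<omega>) + (\<Sum>t=1..T. \<eta> t * (f (x t \<omega>) - f xstar))
          \<le> 2 * (1 + h) * D"
        using bound[OF \<open>\<omega> \<in> B\<close>] rhs by linarith
      have gap: "0 \<le> f (x t \<omega>) - f xstar" if "t \<in> {1..T}" for t
        using f_xstar_le[OF x_in[OF _ _ \<omega>], of t] that by simp
      have "0 \<le> (\<Sum>t=1..T. \<eta> t * (f (x t \<omega>) - f xstar))"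
        using gap \<eta>_pos by (intro sum_nonneg mult_nonneg_nonneg) (auto intro: less_imp_le)
      then have first: "bregman \<psi> d\<psi> xstar (x (T + 1) \<omega>) \<le> 2 * (1 + h) * D"
        using bound_\<omega> by simp
      \<comment> \<open>A lower bound for all step sizes, attained where \<open>c t = T\<close>.\<close>
      define e where "e = sqrt (D / (6 * K * real T))"
      have e: "e > 0" using D K \<open>1 \<le> T\<close> by (simp add: e_def)
      have e_le: "e \<le> \<eta> t" if "1 \<le> t" "t \<le> T" for t
        unfolding e_def \<eta>D[OF that] using c[OF that] D K
        by (intro real_sqrt_le_mono divide_left_mono mult_left_mono mult_pos_pos) auto
      have "0 \<le> bregman \<psi> d\<psi> xstar (x (Suc T) \<omega>)"
        using norm_power2_le_bregman[OF x_in[OF _ _ \<omega>] xstar_in, of "Suc T"]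
          zero_le_power2[of "N (xstar - x (Suc T) \<omega>)"] by linarith
      moreover have "e * (\<Sum>t=1..T. f (x t \<omega>) - f xstar) \<le> (\<Sum>t=1..T. \<eta> t * (f (x t \<omega>) - f xstar))"
        unfolding sum_distrib_left using e_le gap by (intro sum_mono mult_right_mono) auto
      ultimately have "e * (\<Sum>t=1..T. f (x t \<omega>) - f xstar) \<le> 2 * (1 + h) * D"
        using bound_\<omega> by linarith
      then have "(\<Sum>t=1..T. f (x t \<omega>) - f xstar) \<le> 2 * (1 + h) * (D / e)"
        using e by (simp add: field_simps)
      also have "D / e = sqrt (6 * real T) * sqrt (D * K)"
      proof -
        have "D = sqrt D * sqrt D" using D by simp
        then show ?thesis
          using D K \<open>1 \<le> T\<close> by (simp add: e_def real_sqrt_divide real_sqrt_mult field_simps)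
      qed
      finally have "1 / real T * (\<Sum>t=1..T. f (x t \<omega>) - f xstar)
          \<le> 1 / real T * (2 * (1 + h) * (sqrt (6 * real T) * sqrt (D * K)))"
        by (intro mult_left_mono) auto
      also have "\<dots> = 2 * sqrt 6 / sqrt (real T) * (1 + h) * sqrt (D * K)"
      proof -
        have "1 / real T * sqrt (real T) = 1 / sqrt (real T)"
          using \<open>1 \<le> T\<close> by (simp add: real_div_sqrt field_simps)
        moreover have "1 / real T * (2 * (1 + h) * (sqrt (6 * real T) * sqrt (D * K)))
            = (1 / real T * sqrt (real T)) * (2 * sqrt 6 * (1 + h) * sqrt (D * K))"
          unfolding real_sqrt_mult[of 6] by (simp only: mult_ac)
        ultimately show ?thesis by simp
      qed
      finally show "\<omega> \<in> ?A" using \<omega> first by (simp add: D_def)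
    qed
    then have "measure M B \<le> measure M ?A" using A_sets by (rule finite_measure_mono)
    then show ?thesis using B(2) by linarith
  qed
qed

end

lemma sum_inverse_le_1_plus_ln:
  assumes "1 \<le> T"
  shows "(\<Sum>t=1..T. 1 / real t) \<le> 1 + ln (real T)"
proof -
  obtain n where n: "T = Suc n" using assms by (cases T) auto
  have "harm T - ln (real T) \<le> harm 1 - ln (real 1)"
    using decseq_harm_diff_ln[THEN decseqD, of 0 n] by (simp add: n)
  then show ?thesis by (simp add: harm_def inverse_eq_divide)
qed

theorem theorem3p1:
  fixes M :: "'a measure"
    and N :: "real ^ 'd \<Rightarrow> real"
    and X :: "(real ^ 'd) set"
    and f \<psi> :: "real ^ 'd \<Rightarrow> real"
    and df d\<psi> :: "real ^ 'd \<Rightarrow> real ^ 'd"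
    and g x :: "nat \<Rightarrow> 'a \<Rightarrow> real ^ 'd"
    and x1 xstar :: "real ^ 'd"
    and \<eta> :: "nat \<Rightarrow> real"
    and G \<sigma> \<delta> :: real
    and T :: nat
  assumes "prob_space M"
    and "is_norm N"
    and "X \<noteq> {}" and "convex X"
    and "convex_on X f" and "\<And>y. GDERIV f y :> df y"
    and "\<And>y. y \<in> X \<Longrightarrow> dual_norm N (df y) \<le> G"
    and "\<And>y. GDERIV \<psi> y :> d\<psi> y" and "strongly_convex_on N 1 X \<psi>"
    and "is_arg_min f (\<lambda>y. y \<in> X) xstar"
    and "x1 \<in> X"
    and "\<sigma> > 0" and "0 < \<delta>" and "\<delta> < 1" and "T \<ge> 1"
    and "stochastic_mirror_descent M X \<psi> d\<psi> T \<eta> x1 g x"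
    and "unbiased_sub_gaussian_oracle M N df \<sigma> T g x"
  shows "((\<forall>t\<in>{1..T}. \<eta> t =
             sqrt (bregman \<psi> d\<psi> xstar x1 / (6 * (G\<^sup>2 + \<sigma>\<^sup>2 * (1 + ln (1 / \<delta>))) * real T)))
          \<longrightarrow>
          measure M {\<omega> \<in> space M.
              bregman \<psi> d\<psi> xstar (x (T + 1) \<omega>) \<le> 4 * bregman \<psi> d\<psi> xstar x1 \<and>
              1 / real T * (\<Sum>t=1..T. f (x t \<omega>) - f xstar)
                \<le> 4 * sqrt 6 / sqrt (real T) *
                    sqrt (bregman \<psi> d\<psi> xstar x1 * (G\<^sup>2 + \<sigma>\<^sup>2 * (1 + ln (1 / \<delta>))))} \<ge> 1 - \<delta>)
         \<and>
         ((\<forall>t\<in>{1..T}. \<eta> t =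
             sqrt (bregman \<psi> d\<psi> xstar x1 / (6 * (G\<^sup>2 + \<sigma>\<^sup>2 * (1 + ln (1 / \<delta>))) * real t)))
          \<longrightarrow>
          measure M {\<omega> \<in> space M.
              bregman \<psi> d\<psi> xstar (x (T + 1) \<omega>) \<le> 2 * (2 + ln (real T)) * bregman \<psi> d\<psi> xstar x1 \<and>
              1 / real T * (\<Sum>t=1..T. f (x t \<omega>) - f xstar)
                \<le> 2 * sqrt 6 / sqrt (real T) * (2 + ln (real T)) *
                    sqrt (bregman \<psi> d\<psi> xstar x1 * (G\<^sup>2 + \<sigma>\<^sup>2 * (1 + ln (1 / \<delta>))))} \<ge> 1 - \<delta>)"
proof -
  interpret stochastic_mirror_descent_run M N X f \<psi> df d\<psi> g x x1 xstar \<eta> G \<sigma> T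
    using assms by (intro stochastic_mirror_descent_run.intro stochastic_mirror_descent_run_axioms.intro) auto
  note bound = schedule_bound[OF \<open>0 < \<delta>\<close> \<open>\<delta> < 1\<close> \<open>T \<ge> 1\<close>]
  show ?thesis
  proof (intro conjI impI)
    assume "\<forall>t\<in>{1..T}. \<eta> t =
      sqrt (bregman \<psi> d\<psi> xstar x1 / (6 * (G\<^sup>2 + \<sigma>\<^sup>2 * (1 + ln (1 / \<delta>))) * real T))"
    then show "measure M {\<omega> \<in> space M.
        bregman \<psi> d\<psi> xstar (x (T + 1) \<omega>) \<le> 4 * bregman \<psi> d\<psi> xstar x1 \<and>
        1 / real T * (\<Sum>t=1..T. f (x t \<omega>) - f xstar)
          \<le> 4 * sqrt 6 / sqrt (real T) *
              sqrt (bregman \<psi> d\<psi> xstar x1 * (G\<^sup>2 + \<sigma>\<^sup>2 * (1 + ln (1 / \<delta>))))} \<ge> 1 - \<delta>"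
      using bound[of "\<lambda>_. real T" 1] \<open>T \<ge> 1\<close> by (simp add: mult.commute)
  next
    assume "\<forall>t\<in>{1..T}. \<eta> t =
      sqrt (bregman \<psi> d\<psi> xstar x1 / (6 * (G\<^sup>2 + \<sigma>\<^sup>2 * (1 + ln (1 / \<delta>))) * real t))"
    then show "measure M {\<omega> \<in> space M.
        bregman \<psi> d\<psi> xstar (x (T + 1) \<omega>) \<le> 2 * (2 + ln (real T)) * bregman \<psi> d\<psi> xstar x1 \<and>
        1 / real T * (\<Sum>t=1..T. f (x t \<omega>) - f xstar)
          \<le> 2 * sqrt 6 / sqrt (real T) * (2 + ln (real T)) *
              sqrt (bregman \<psi> d\<psi> xstar x1 * (G\<^sup>2 + \<sigma>\<^sup>2 * (1 + ln (1 / \<delta>))))} \<ge> 1 - \<delta>"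
      using bound[of real "1 + ln (real T)"] sum_inverse_le_1_plus_ln[OF \<open>T \<ge> 1\<close>]
      by (simp add: add.assoc[symmetric])
  qed
qed

end
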